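(* Let $Q^T\tau$ be a system of pairwise comparisons of $v$ treatments with $\mathrm{rank}(Q)=r$, let $w>0$ be a feasible design and let $G$ be the corresponding vertex-weighted graph, with vertex weights $\alpha_i=w_i^{-1}$. Then $\Psi_0(w)=\kappa_{v-r}(G)$ and $\Phi_0(w)=1/\kappa_{v-r}(G)$.
   Context: A system of $s$ pairwise comparisons $Q^T\tau$ of the treatment effects $\tau=(\tau_1,\ldots,\tau_v)^T$ is given by a $v\times s$ matrix $Q$ every column of which represents a difference $\tau_j-\tau_i$ with $i\ne j$ (entry $1$ in row $j$, $-1$ in row $i$, zeros elsewhere); no row of $Q$ is zero. The corresponding directed graph $G=(V,E)$ has $V=\{1,\ldots,v\}$ and an edge $(j,i)$, directed from $j$ to $i$, for each comparison $\tau_j-\tau_i$ in the system; loops and multiple edges between two vertices are not allowed. A design is a vector $w=(w_1,\ldots,w_v)^T$ with $w_i\in[0,1]$, $\sum_i w_i=1$; it is feasible if and only if $w_i>0$ for all $i$. Let $V_Q(w)=Q^T\mathrm{diag}(w)^{-1}Q$, with eigenvalues ordered decreasingly. Then $\Psi_0(w)=\prod_{j=1}^r\lambda_j(V_Q(w))$ (the product of the positive eigenvalues of $V_Q(w)$), and $\Phi_0(w)=\big(\prod_{j=1}^r\lambda_j(C_Q(w))\big)^{1/r}$, where $C_Q(w)=V_Q(w)^+$ is the Moore-Penrose pseudoinverse (equal to the information matrix $V_Q(w)^{-1}$ when $Q$ has full column rank). Definition of $\kappa_k(G)$, $k\in\{1,\ldots,v-1\}$: let $S\subseteq V$ with $|S|=k$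 and let $X$ be a set of $v-k$ edges of $G$. If $(V,X)$ is a spanning forest (a subgraph of $G$ containing no cycle, disregarding the orientations of the edges) and each of its subtrees contains exactly one vertex in $S$, the rooted spanning forest $X_S$ is obtained by orienting all edges of $X$ towards $S$. Its weight is $\omega(X_S)=\prod_{(i,j)\in E(X_S)}\alpha_j$, where $(i,j)$ denotes an edge directed from $i$ to $j$. Then $\kappa_S(G)=\sum_{X_S}\omega(X_S)$ is the total weight of all rooted spanning forests induced by $S$, and $\kappa_k(G)=\sum_{S:|S|=k}\kappa_S(G)$ is the sum of weights of all rooted directed spanning forests with $k$ roots.
   Formalization: Two formulas are corrected, as the claim fails otherwise (path on 3 vertices, w=(1/2,1/4,1/4)): with edges directed towards the roots, a forest's weight is the product of α_i at edge tails, not α_j at heads; and Φ_0(w)=(1/κ_{v-r}(G))^{1/r} rather than 1/κ_{v-r}(G). *)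

theory Defs
  imports
    "Jordan_Normal_Form.Char_Poly"
    "Jordan_Normal_Form.DL_Rank"
begin

section \<open>Systems of pairwise comparisons and designs\<close>

text \<open>Treatments are numbered \<open>0, \<dots>, v - 1\<close>. The last conjunct excludes multiple edges between
  two treatments: no difference occurs twice, with the same or with the opposite sign.\<close>

definition pairwise_comparisons :: "nat \<Rightarrow> nat \<Rightarrow> real mat \<Rightarrow> bool" where
  "pairwise_comparisons v s Q \<longleftrightarrow>
     Q \<in> carrier_mat v s \<and>
     (\<forall>c<s. \<exists>j<v. \<exists>i<v. i \<noteq> j \<and> col Q c = unit_vec v j - unit_vec v i) \<and>
     (\<forall>i<v. row Q i \<noteq> 0\<^sub>v s) \<and>
     (\<forall>c<s. \<forall>d<s. c \<noteq> d \<longrightarrow> col Q c \<noteq> col Q d \<and> col Q c \<noteq> - col Q d)"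

definition design :: "nat \<Rightarrow> real vec \<Rightarrow> bool" where
  "design v w \<longleftrightarrow> w \<in> carrier_vec v \<and> (\<forall>i<v. w $ i \<in> {0..1}) \<and> (\<Sum>i<v. w $ i) = 1"

definition feasible :: "real vec \<Rightarrow> bool" where
  "feasible w \<longleftrightarrow> (\<forall>i<dim_vec w. w $ i > 0)"


section \<open>Eigenvalues and the Moore-Penrose pseudoinverse\<close>

text \<open>Eigenvalues are listed decreasingly, with multiplicity, and numbered from 1. Only real roots
  of the characteristic polynomial are listed, which is all of them for a symmetric matrix.\<close>

definition eigenvalues_decr :: "real mat \<Rightarrow> real list" where
  "eigenvalues_decr A = rev (sorted_list_of_multiset (proots (char_poly A)))"

definition eig :: "nat \<Rightarrow> real mat \<Rightarrow> real" where
  "eig j A = eigenvalues_decr A ! (j - 1)"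

definition is_pseudoinverse :: "real mat \<Rightarrow> real mat \<Rightarrow> bool" where
  "is_pseudoinverse A X \<longleftrightarrow>
     X \<in> carrier_mat (dim_col A) (dim_row A) \<and>
     A * X * A = A \<and> X * A * X = X \<and>
     transpose_mat (A * X) = A * X \<and> transpose_mat (X * A) = X * A"

definition pseudoinverse :: "real mat \<Rightarrow> real mat" where
  "pseudoinverse A = (THE X. is_pseudoinverse A X)"


section \<open>The criteria\<close>

definition V_mat :: "real mat \<Rightarrow> real vec \<Rightarrow> real mat" where
  "V_mat Q w = transpose_mat Q * mat_diag (dim_row Q) (\<lambda>i. inverse (w $ i)) * Q"

definition C_mat :: "real mat \<Rightarrow> real vec \<Rightarrow> real mat" where
  "C_mat Q w = pseudoinverse (V_mat Q w)"

definition mat_rank :: "real mat \<Rightarrow> nat" where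
  "mat_rank Q = vec_space.rank (dim_row Q) Q"

definition Psi0 :: "real mat \<Rightarrow> real vec \<Rightarrow> real" where
  "Psi0 Q w = (\<Prod>j = 1..mat_rank Q. eig j (V_mat Q w))"

definition Phi0 :: "real mat \<Rightarrow> real vec \<Rightarrow> real" where
  "Phi0 Q w = (\<Prod>j = 1..mat_rank Q. eig j (C_mat Q w)) powr (1 / real (mat_rank Q))"


section \<open>Rooted spanning forests of a vertex-weighted graph\<close>

record 'a vw_graph =
  vertices :: "'a set"
  edges :: "('a \<times> 'a) set"
  vweight :: "'a \<Rightarrow> real"

definition comparison_graph :: "real mat \<Rightarrow> real vec \<Rightarrow> nat vw_graph" where
  "comparison_graph Q w =
     \<lparr>vertices = {..<dim_row Q},
      edges = {(j, i). j < dim_row Q \<and> i < dim_row Q \<and> j \<noteq> i \<and>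
                 (\<exists>c<dim_col Q. col Q c = unit_vec (dim_row Q) j - unit_vec (dim_row Q) i)},
      vweight = (\<lambda>i. inverse (w $ i))\<rparr>"

definition undirected :: "('a \<times> 'a) set \<Rightarrow> ('a \<times> 'a) set" where
  "undirected X = X \<union> X\<inverse>"

text \<open>A cycle is given by its cyclic sequence of distinct vertices. Cycles of length 1 or 2 cannot
  occur, as there are neither loops nor multiple edges.\<close>

definition cycle_free :: "('a \<times> 'a) set \<Rightarrow> bool" where
  "cycle_free X \<longleftrightarrow>
     \<not> (\<exists>p. 3 \<le> length p \<and> distinct p \<and>
            (\<forall>i<length p. (p ! i, p ! (Suc i mod length p)) \<in> undirected X))"

definition spans_forest_with_roots :: "'a vw_graph \<Rightarrow> 'a set \<Rightarrow> ('a \<times> 'a) set \<Rightarrow> bool" where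
  "spans_forest_with_roots G S X \<longleftrightarrow>
     X \<subseteq> edges G \<and> card X = card (vertices G) - card S \<and> cycle_free X \<and>
     (\<forall>u\<in>vertices G. \<exists>!s. s \<in> S \<and> (u, s) \<in> (undirected X)\<^sup>*)"

text \<open>An edge between \<open>a\<close> and \<open>b\<close> is directed from \<open>a\<close> to \<open>b\<close> if it is \<open>b\<close> that remains connected
  to a root once the edge is deleted.\<close>

definition orient_towards :: "'a set \<Rightarrow> ('a \<times> 'a) set \<Rightarrow> ('a \<times> 'a) set" where
  "orient_towards S X =
     {(a, b). (a, b) \<in> undirected X \<and>
        (\<exists>s\<in>S. (b, s) \<in> (undirected (X - {(a, b), (b, a)}))\<^sup>*)}"

text \<open>With the edges directed towards the roots, an edge carries the weight of the vertex that it
  leaves, so that every vertex other than a root contributes its weight exactly once. This is the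
  convention that matches \<open>V_mat\<close>; taking the weight of the vertex that the edge enters gives a
  different total. For \<open>v = 3\<close>, the comparisons \<open>\<tau>\<^sub>0 - \<tau>\<^sub>1\<close> and \<open>\<tau>\<^sub>1 - \<tau>\<^sub>2\<close>, and
  \<open>w = (1/2, 1/4, 1/4)\<close>, the matrix \<open>V_mat\<close> has determinant 32; the weight of the vertex left gives
  32 and that of the vertex entered gives 40.\<close>

definition forest_weight :: "('a \<Rightarrow> real) \<Rightarrow> ('a \<times> 'a) set \<Rightarrow> real" where
  "forest_weight \<alpha> F = (\<Prod>(i, j)\<in>F. \<alpha> i)"

definition kappa_roots :: "'a vw_graph \<Rightarrow> 'a set \<Rightarrow> real" where
  "kappa_roots G S =
     (\<Sum>X | spans_forest_with_roots G S X. forest_weight (vweight G) (orient_towards S X))"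

definition kappa :: "nat \<Rightarrow> 'a vw_graph \<Rightarrow> real" where
  "kappa k G = (\<Sum>S | S \<subseteq> vertices G \<and> card S = k. kappa_roots G S)"

end

theory Submission
  imports Defs
begin

text \<open>Write \<open>V\<close> for \<open>V_mat Q w\<close> and \<open>W\<close> for the diagonal matrix of the weights. By the Schur complement,
  \<open>det W * det (V + x I)\<close> is the determinant of the matrix with the blocks \<open>W\<close>, \<open>- Q\<close>, \<open>Q\<^sup>T\<close>, \<open>x I\<close>.
  Its expansion along the diagonal is a sum over sets \<open>R\<close> of vertices and \<open>T\<close> of edges of principal
  minors of the same matrix with zero diagonal. Repeated expansion at a pendant vertex in \<open>R\<close> shows
  that such a minor is 1 if \<open>T\<close> is a spanning forest with the complement of \<open>R\<close> as its set of roots,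
  and 0 otherwise. So the coefficient of \<open>x\<close> to the power \<open>s - r\<close> in \<open>det (V + x I)\<close> is
  \<open>\<kappa>\<^bsub>v - r\<^esub>\<close>. By the spectral theorem \<open>V\<close> has exactly \<open>r\<close> nonzero eigenvalues, so this
  coefficient is their product, and the nonzero eigenvalues of the pseudoinverse are their
  reciprocals.\<close>

section \<open>Orthogonal diagonalization of real symmetric matrices\<close>

text \<open>Summing the minors over \<open>R\<close> and \<open>T\<close> amounts to a Cauchy-Binet
  expansion. Since a minor of the bordered matrix is the square of a minor of \<open>Q\<close>, no
  signs of incidence minors have to be tracked. Each term carries the product of \<open>w\<close>
  over the complement of \<open>R\<close>. Dividing by \<open>det W\<close> turns it into the
  product of the inverse weights over \<open>R\<close>, the non-roots, and this is the forest weight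
  because each non-root is left by exactly one edge. The parameter \<open>x\<close> is there because
  the columns of \<open>Q\<close> may be dependent: a cycle in the graph makes \<open>V\<close>
  singular. A degree count supplies the pendant vertices: with as many edges in \<open>T\<close> as
  vertices in \<open>R\<close>, either some vertex of \<open>R\<close> meets at most one edge, or
  all edges stay inside \<open>R\<close> and the minor vanishes. The same stripping of pendant
  vertices recovers acyclicity, uniqueness of roots and the orientation from mere reachability and
  the number of edges. Since \<open>Phi0\<close> is defined with an r-th root, its identity carries
  the exponent \<open>1 / real r\<close>.\<close>

lemma symmetric_bilinear:
  fixes A :: "'a :: comm_ring_1 mat"
  assumes A: "A \<in> carrier_mat n n" and sym: "transpose_mat A = A"
    and x: "x \<in> carrier_vec n" and y: "y \<in> carrier_vec n"
  shows "x \<bullet> (A *\<^sub>v y) = y \<bullet> (A *\<^sub>v x)"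
  using transpose_vec_mult_scalar[OF A y x] sym A x y
  by (metis comm_scalar_prod mult_mat_vec_carrier)

lemma scalar_prod_self_pos:
  fixes x :: "real vec"
  assumes "x \<in> carrier_vec n" "x \<noteq> 0\<^sub>v n"
  shows "x \<bullet> x > 0"
proof -
  obtain i where i: "i < n" "x $ i \<noteq> 0"
    using assms by (metis eq_vecI carrier_vecD index_zero_vec)
  have "0 < (\<Sum>i = 0..<n. x $ i * x $ i)"
    using i by (intro sum_pos2[of _ i]) (auto simp: zero_less_mult_iff)
  then show ?thesis using assms by (simp add: scalar_prod_def)
qed

text \<open>Over the complex numbers the characteristic polynomial has a root \<open>l\<close>.
  Split its eigenvector into real and imaginary parts \<open>x\<close> and \<open>y\<close>:
  comparing \<open>y \<bullet> (A *\<^sub>v x)\<close> with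
  \<open>x \<bullet> (A *\<^sub>v y)\<close> leaves
  \<open>Im l * (x \<bullet> x + y \<bullet> y) = 0\<close>. So \<open>l\<close> is real, and
  whichever of \<open>x\<close>, \<open>y\<close> is nonzero can be normalized.\<close>

lemma symmetric_real_eigenvector:
  fixes A :: "real mat"
  assumes A: "A \<in> carrier_mat n n" and sym: "transpose_mat A = A" and n: "0 < n"
  obtains e v where "v \<in> carrier_vec n" "v \<bullet> v = 1" "A *\<^sub>v v = e \<cdot>\<^sub>v v"
proof -
  let ?C = "map_mat complex_of_real A"
  have C: "?C \<in> carrier_mat n n" using A by simp
  obtain as where as: "char_poly ?C = (\<Prod>a\<leftarrow>as. [:- a, 1:])" "length as = n"
    using char_poly_factorized[OF C] by blast
  then obtain l where "l \<in> set as" using n by (cases as) auto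
  then have "poly (char_poly ?C) l = 0" unfolding as by (auto simp: poly_prod_list prod_list_zero_iff)
  then obtain z where z: "z \<in> carrier_vec n" "z \<noteq> 0\<^sub>v n" "?C *\<^sub>v z = l \<cdot>\<^sub>v z"
    using eigenvalue_root_char_poly[OF C] C unfolding eigenvalue_def eigenvector_def by auto
  define x y where "x = map_vec Re z" and "y = map_vec Im z"
  have xy: "x \<in> carrier_vec n" "y \<in> carrier_vec n" using z by (auto simp: x_def y_def)
  have idx: "(\<Sum>k = 0..<n. of_real (A $$ (i, k)) * z $ k) = l * z $ i" if "i < n" for i
    using arg_cong[OF z(3), of "\<lambda>u. u $ i"] that z(1) A by (simp add: scalar_prod_def)
  have re: "(\<Sum>k = 0..<n. A $$ (i, k) * x $ k) = Re l * x $ i - Im l * y $ i" if "i < n" for i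
    using arg_cong[OF idx[OF that], of Re] that z(1) by (simp add: x_def y_def)
  have im: "(\<Sum>k = 0..<n. A $$ (i, k) * y $ k) = Re l * y $ i + Im l * x $ i" if "i < n" for i
    using arg_cong[OF idx[OF that], of Im] that z(1) by (simp add: x_def y_def)
  have Ax: "A *\<^sub>v x = Re l \<cdot>\<^sub>v x - Im l \<cdot>\<^sub>v y"
    using A xy re by (intro eq_vecI) (auto simp: scalar_prod_def)
  have Ay: "A *\<^sub>v y = Re l \<cdot>\<^sub>v y + Im l \<cdot>\<^sub>v x"
    using A xy im by (intro eq_vecI) (auto simp: scalar_prod_def)
  have nz: "x \<noteq> 0\<^sub>v n \<or> y \<noteq> 0\<^sub>v n"
  proof (rule ccontr)
    assume "\<not> ?thesis"
    then have "z $ i = 0" if "i < n" for i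
      using that z(1) by (metis x_def y_def carrier_vecD complex_eqI index_map_vec(1) index_zero_vec(1)
          zero_complex.simps)
    then show False using z by (metis eq_vecI carrier_vecD index_zero_vec)
  qed
  have pos: "x \<bullet> x + y \<bullet> y > 0"
    using nz scalar_prod_self_pos[OF xy(1)] scalar_prod_self_pos[OF xy(2)] xy
    by (cases "x = 0\<^sub>v n"; cases "y = 0\<^sub>v n") auto
  have "y \<bullet> (A *\<^sub>v x) = Re l * (y \<bullet> x) - Im l * (y \<bullet> y)"
    unfolding Ax using xy by (subst scalar_prod_minus_distrib[of _ n]) auto
  moreover have "x \<bullet> (A *\<^sub>v y) = Re l * (x \<bullet> y) + Im l * (x \<bullet> x)"
    unfolding Ay using xy by (subst scalar_prod_add_distrib[of _ n]) auto
  ultimately have "Im l * (x \<bullet> x + y \<bullet> y) = 0"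
    using symmetric_bilinear[OF A sym xy] comm_scalar_prod[OF xy] by (simp add: algebra_simps)
  then have l: "Im l = 0" using pos by simp
  obtain u where u: "u \<in> carrier_vec n" "u \<noteq> 0\<^sub>v n" "A *\<^sub>v u = Re l \<cdot>\<^sub>v u"
  proof -
    have "0 \<cdot>\<^sub>v x = 0\<^sub>v n" "0 \<cdot>\<^sub>v y = 0\<^sub>v n" using xy by auto
    then have "A *\<^sub>v x = Re l \<cdot>\<^sub>v x" "A *\<^sub>v y = Re l \<cdot>\<^sub>v y" using Ax Ay l xy by auto
    then show ?thesis using nz xy that by blast
  qed
  define c where "c = 1 / sqrt (u \<bullet> u)"
  show thesis
  proof (rule that)
    show "c \<cdot>\<^sub>v u \<in> carrier_vec n" using u by simp
    show "(c \<cdot>\<^sub>v u) \<bullet> (c \<cdot>\<^sub>v u) = 1"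
      using u scalar_prod_self_pos[OF u(1,2)] by (simp add: c_def field_simps)
    show "A *\<^sub>v (c \<cdot>\<^sub>v u) = Re l \<cdot>\<^sub>v (c \<cdot>\<^sub>v u)"
      using u A by (simp add: mult_mat_vec smult_smult_assoc mult.commute)
  qed
qed

text \<open>The reflection in the hyperplane orthogonal to the difference \<open>u\<close> of two
  unit vectors swaps them. It serves to move an eigenvector to the first coordinate axis.\<close>

lemma householder_reflection:
  fixes v :: "real vec"
  assumes v: "v \<in> carrier_vec n" and unit: "v \<bullet> v = 1" and n: "0 < n"
  obtains W where "W \<in> carrier_mat n n" "transpose_mat W = W" "W * W = 1\<^sub>m n"
    "W *\<^sub>v unit_vec n 0 = v"
proof -
  define u where "u = v - unit_vec n 0"
  \<comment> \<open>If \<open>v\<close> is already the first unit vector, then \<open>u = 0\<close>,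
    division by zero gives \<open>c = 0\<close>, and \<open>W\<close> is the identity.\<close>
  define c where "c = 2 / (u \<bullet> u)"
  define W where "W = mat n n (\<lambda>(i, j). (if i = j then 1 else 0) - c * (u $ i * u $ j))"
  have u: "u \<in> carrier_vec n" using v by (simp add: u_def)
  have uu: "u \<bullet> u = (\<Sum>k = 0..<n. u $ k * u $ k)" using u by (simp add: scalar_prod_def)
  have "u \<bullet> u = v \<bullet> v - 2 * v $ 0 + 1"
    unfolding u_def using v n
    by (simp add: minus_scalar_prod_distrib[of _ n] scalar_prod_minus_distrib[of _ n])
  then have uu0: "u \<bullet> u = - 2 * u $ 0" using v n unit by (simp add: u_def)
  \<comment> \<open>Hence the first column of \<open>W\<close> is the first unit vector plus
    \<open>u\<close>, which is \<open>v\<close>.\<close>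
  have c0: "c * (u $ i * u $ 0) = - u $ i" if "i < n" for i
  proof (cases "u = 0\<^sub>v n")
    case True
    then show ?thesis using that by simp
  next
    case False
    then have "u \<bullet> u > 0" using scalar_prod_self_pos[OF u] by simp
    then show ?thesis unfolding c_def uu0 by (simp add: field_simps)
  qed
  show thesis
  proof (rule that)
    show "W \<in> carrier_mat n n" by (simp add: W_def)
    show "transpose_mat W = W" by (rule eq_matI) (auto simp: W_def)
    show "W * W = 1\<^sub>m n"
    proof (rule eq_matI)
      fix i j assume "i < dim_row (1\<^sub>m n :: real mat)" "j < dim_col (1\<^sub>m n :: real mat)"
      then have ij: "i < n" "j < n" by auto
      let ?d = "\<lambda>i j. if i = j then 1 else 0 :: real"
      have "(W * W) $$ (i, j)
          = (\<Sum>k = 0..<n. (?d i k - c * (u $ i * u $ k)) * (?d k j - c * (u $ k * u $ j)))"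
        using ij by (simp add: W_def scalar_prod_def)
      also have "\<dots> = (\<Sum>k = 0..<n. ?d i k * ?d k j - (if k = i then c * (u $ k * u $ j) else 0)
          - (if k = j then c * (u $ i * u $ k) else 0) + c * c * u $ i * u $ j * (u $ k * u $ k))"
        by (intro sum.cong) (auto simp: algebra_simps)
      also have "\<dots> = (\<Sum>k = 0..<n. ?d i k * ?d k j) - c * (u $ i * u $ j) - c * (u $ i * u $ j)
          + c * c * u $ i * u $ j * (u \<bullet> u)"
        using ij by (simp add: sum.distrib sum_subtractf uu sum_distrib_left)
      also have "(\<Sum>k = 0..<n. ?d i k * ?d k j) = (\<Sum>k = 0..<n. if k = i then ?d i j else 0)"
        by (intro sum.cong) auto
      also have "\<dots> = ?d i j" using ij by simp
      also have "c * c * u $ i * u $ j * (u \<bullet> u) = 2 * c * (u $ i * u $ j)"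
        by (simp add: c_def)
      finally show "(W * W) $$ (i, j) = 1\<^sub>m n $$ (i, j)" using ij by simp
    qed (auto simp: W_def)
    show "W *\<^sub>v unit_vec n 0 = v"
    proof (rule eq_vecI)
      fix i assume "i < dim_vec v"
      then have i: "i < n" using v by simp
      have "(W *\<^sub>v unit_vec n 0) $ i = W $$ (i, 0)"
        using i n by (simp add: W_def)
      also have "\<dots> = (if i = 0 then 1 else 0) + u $ i" using i n c0[OF i]
        by (simp add: W_def)
      also have "\<dots> = v $ i" using i v n by (simp add: u_def)
      finally show "(W *\<^sub>v unit_vec n 0) $ i = v $ i" .
    qed (use v in \<open>simp add: W_def\<close>)
  qed
qed

text \<open>Deflation: conjugating with the reflection \<open>W\<close> that sends the first unit
  vector to an eigenvector gives a matrix \<open>B\<close> whose first column is a multiple of that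
  unit vector. By symmetry the first row is too, so \<open>B\<close> is block diagonal and the
  induction hypothesis applies to the lower block.\<close>

theorem symmetric_real_diagonalization:
  fixes A :: "real mat"
  assumes "A \<in> carrier_mat n n" and "transpose_mat A = A"
  obtains U f where "U \<in> carrier_mat n n" "transpose_mat U * U = 1\<^sub>m n"
    "A = U * mat_diag n f * transpose_mat U"
proof -
  have "\<exists>U f. U \<in> carrier_mat n n \<and> transpose_mat U * U = 1\<^sub>m n
      \<and> A = U * mat_diag n f * transpose_mat U"
    using assms
  proof (induction n arbitrary: A)
    case 0
    show ?case by (rule exI[of _ "1\<^sub>m 0"]) (use 0 in \<open>auto intro!: eq_matI\<close>)
  next
    case (Suc m)
    let ?n = "Suc m"
    obtain e v where v: "v \<in> carrier_vec ?n" "v \<bullet> v = 1" "A *\<^sub>v v = e \<cdot>\<^sub>v v"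
      using symmetric_real_eigenvector[OF Suc.prems] by blast
    obtain W where W: "W \<in> carrier_mat ?n ?n" "transpose_mat W = W" "W * W = 1\<^sub>m ?n"
      "W *\<^sub>v unit_vec ?n 0 = v"
      using householder_reflection[OF v(1,2)] by blast
    note A = Suc.prems(1)
    define B where "B = W * A * W"
    have B: "B \<in> carrier_mat ?n ?n" using W A by (simp add: B_def)
    have Wv: "W *\<^sub>v v = unit_vec ?n 0"
      using W by (metis assoc_mult_mat_vec one_mult_mat_vec unit_vec_carrier)
    have "transpose_mat B = B"
      unfolding B_def using W A Suc.prems(2)
      by (simp add: transpose_mult[of _ ?n ?n _ ?n] assoc_mult_mat[of _ ?n ?n _ ?n _ ?n])
    then have Bsym: "B $$ (i, j) = B $$ (j, i)" if "i < ?n" "j < ?n" for i j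
      using B that by (metis carrier_matD index_transpose_mat(1))
    have "B *\<^sub>v unit_vec ?n 0 = W *\<^sub>v (A *\<^sub>v (W *\<^sub>v unit_vec ?n 0))"
      unfolding B_def using W(1) A by (simp add: assoc_mult_mat_vec[of _ ?n ?n _ ?n])
    also have "\<dots> = e \<cdot>\<^sub>v unit_vec ?n 0"
      using W v Wv by (simp add: mult_mat_vec)
    finally have "(B *\<^sub>v unit_vec ?n 0) $ i = (e \<cdot>\<^sub>v unit_vec ?n 0) $ i" for i by simp
    then have B0: "B $$ (i, 0) = (if i = 0 then e else 0)" if "i < ?n" for i
      using that B by (metis carrier_matD index_mult_mat_vec index_row(1) index_smult_vec(1)
          index_unit_vec(1,3) mult.right_neutral mult_zero_right scalar_prod_right_unit zero_less_Suc)
    define A3 where "A3 = mat m m (\<lambda>(i, j). B $$ (Suc i, Suc j))"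
    have A3: "A3 \<in> carrier_mat m m" by (simp add: A3_def)
    moreover have "transpose_mat A3 = A3" by (rule eq_matI) (auto simp: A3_def Bsym)
    ultimately obtain U3 f3 where IH: "U3 \<in> carrier_mat m m" "transpose_mat U3 * U3 = 1\<^sub>m m"
      "A3 = U3 * mat_diag m f3 * transpose_mat U3"
      using Suc.IH by blast
    define U' where "U' = four_block_mat (1\<^sub>m 1) (0\<^sub>m 1 m) (0\<^sub>m m 1) U3"
    have U': "U' \<in> carrier_mat ?n ?n"
      using four_block_carrier_mat[OF one_carrier_mat[of 1] IH(1)] by (simp add: U'_def)
    have U't: "transpose_mat U' = four_block_mat (1\<^sub>m 1) (0\<^sub>m 1 m) (0\<^sub>m m 1) (transpose_mat U3)"
      unfolding U'_def using IH by (subst transpose_four_block_mat) auto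
    have U'U': "transpose_mat U' * U' = 1\<^sub>m ?n"
      unfolding U't unfolding U'_def using IH
      by (subst mult_four_block_mat[of _ 1 1 _ m _ m _ _ 1 _ m]) auto
    define f where "f = case_nat e f3"
    have D: "mat_diag ?n f = four_block_mat (mat_diag 1 (\<lambda>_. e)) (0\<^sub>m 1 m) (0\<^sub>m m 1) (mat_diag m f3)"
      by (rule eq_matI) (auto simp: mat_diag_def f_def split: nat.split)
    have "U' * mat_diag ?n f * transpose_mat U'
        = four_block_mat (mat_diag 1 (\<lambda>_. e)) (0\<^sub>m 1 m) (0\<^sub>m m 1) A3"
      unfolding D U't IH(3) unfolding U'_def using IH(1)
      by (simp add: mult_four_block_mat[of _ 1 1 _ m _ m _ _ 1 _ m]
          left_mult_zero_mat[of _ m m] right_mult_zero_mat[of _ m m]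
          right_add_zero_mat[of _ "Suc 0" "Suc 0"] left_add_zero_mat[of _ m m]
          right_mult_zero_mat[of _ "Suc 0" "Suc 0"]
          mult_carrier_mat[of "U3 * mat_diag m f3" m m _ m] mult_carrier_mat[of U3 m m _ m]
          left_mult_zero_mat[of _ "Suc 0" "Suc 0"] left_mult_one_mat[of _ "Suc 0" "Suc 0"] right_mult_one_mat[of _ "Suc 0" "Suc 0"])
    also have "\<dots> = B"
      using B B0 Bsym[of 0] by (intro eq_matI) (auto simp: A3_def mat_diag_def)
    finally have BD: "U' * mat_diag ?n f * transpose_mat U' = B" .
    have "W * B * W = A"
    proof -
      have "W * B * W = (W * W) * A * (W * W)"
        unfolding B_def using W(1) A by (simp add: assoc_mult_mat[of _ ?n ?n _ ?n _ ?n])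
      then show ?thesis using W A by simp
    qed
    then have "A = W * (U' * mat_diag ?n f * transpose_mat U') * W" unfolding BD by simp
    also have "\<dots> = (W * U') * mat_diag ?n f * transpose_mat (W * U')"
    proof -
      define D where "D = mat_diag ?n f"
      have D: "D \<in> carrier_mat ?n ?n" by (simp add: D_def)
      have Ut: "transpose_mat U' \<in> carrier_mat ?n ?n" using U' by simp
      have "transpose_mat (W * U') = transpose_mat U' * W"
        using W(1,2) U' by (simp add: transpose_mult[of _ ?n ?n _ ?n])
      moreover have "W * (U' * D * transpose_mat U') * W = W * (U' * D) * transpose_mat U' * W"
        using assoc_mult_mat[OF W(1) mult_carrier_mat[OF U' D] Ut] by simp
      moreover have "\<dots> = W * U' * D * (transpose_mat U' * W)"
        using assoc_mult_mat[OF W(1) U' D]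
          assoc_mult_mat[OF mult_carrier_mat[OF mult_carrier_mat[OF W(1) U'] D] Ut W(1)] by simp
      ultimately show ?thesis unfolding D_def by simp
    qed
    finally have "A = (W * U') * mat_diag ?n f * transpose_mat (W * U')" .
    moreover have "transpose_mat (W * U') * (W * U') = 1\<^sub>m ?n"
    proof -
      have "transpose_mat (W * U') * (W * U') = transpose_mat U' * ((W * W) * U')"
        using W(1,2) U' by (simp add: transpose_mult[of _ ?n ?n _ ?n] assoc_mult_mat[of _ ?n ?n _ ?n _ ?n])
      then show ?thesis using W U' U'U' by simp
    qed
    moreover have "W * U' \<in> carrier_mat ?n ?n" using W U' by simp
    ultimately show ?case by blast
  qed
  then show thesis using that by blast
qed

section \<open>Rooted spanning forests\<close>

text \<open>Only the existence of a root is kept from the forest condition. This is what the minors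
  detect; with the right number of edges it also forces acyclicity and uniqueness of the
  root.\<close>

definition reaches :: "'a set \<Rightarrow> 'a set \<Rightarrow> ('a \<times> 'a) set \<Rightarrow> bool" where
  "reaches V S X \<longleftrightarrow> (\<forall>u\<in>V. \<exists>s\<in>S. (u, s) \<in> (undirected X)\<^sup>*)"

definition incident :: "'a \<Rightarrow> 'a \<times> 'a \<Rightarrow> bool" where
  "incident i e \<longleftrightarrow> i = fst e \<or> i = snd e"

lemma undirected_insert:
  "e = (i, b) \<or> e = (b, i) \<Longrightarrow> undirected (insert e X) = {(i, b), (b, i)} \<union> undirected X"
  by (auto simp: undirected_def)

lemma undirected_mono: "X \<subseteq> Y \<Longrightarrow> undirected X \<subseteq> undirected Y"
  by (auto simp: undirected_def)

lemma not_incident_undirected: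
  assumes "\<forall>e\<in>X. \<not> incident i e" "(x, y) \<in> undirected X"
  shows "x \<noteq> i" "y \<noteq> i"
  using assms by (force simp: undirected_def incident_def)+

section \<open>Paths and reachability at a pendant edge\<close>

lemma rtrancl_isolated:
  assumes iso: "\<forall>e\<in>X. \<not> incident i e"
  shows "(u, i) \<in> (undirected X)\<^sup>* \<longleftrightarrow> u = i" "(i, u) \<in> (undirected X)\<^sup>* \<longleftrightarrow> u = i"
proof -
  show "(u, i) \<in> (undirected X)\<^sup>* \<longleftrightarrow> u = i"
    using not_incident_undirected[OF iso] by (metis rtranclE rtrancl.rtrancl_refl)
  show "(i, u) \<in> (undirected X)\<^sup>* \<longleftrightarrow> u = i"
    using not_incident_undirected[OF iso] by (metis converse_rtranclE rtrancl.rtrancl_refl)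
qed

text \<open>Contracting the pendant edge maps a path with it to a path without it.\<close>

lemma rtrancl_insert_leaf:
  assumes iso: "\<forall>e\<in>X. \<not> incident i e" and e: "e = (i, b) \<or> e = (b, i)"
    and "u \<noteq> i" "s \<noteq> i"
  shows "(u, s) \<in> (undirected (insert e X))\<^sup>* \<longleftrightarrow> (u, s) \<in> (undirected X)\<^sup>*"
proof
  let ?h = "\<lambda>x. if x = i then b else x"
  assume "(u, s) \<in> (undirected (insert e X))\<^sup>*"
  then have "(?h u, ?h s) \<in> (undirected X)\<^sup>*"
  proof (induction rule: rtrancl_induct)
    case (step y z)
    have "(?h y, ?h z) \<in> (undirected X)\<^sup>*"
      using step.hyps(2) not_incident_undirected[OF iso, of y z]
      unfolding undirected_insert[OF e] by auto
    then show ?case by (rule rtrancl_trans[OF step.IH])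
  qed simp
  then show "(u, s) \<in> (undirected X)\<^sup>*" using assms by simp
next
  assume "(u, s) \<in> (undirected X)\<^sup>*"
  then show "(u, s) \<in> (undirected (insert e X))\<^sup>*"
    by (rule rev_subsetD) (intro rtrancl_mono undirected_mono subset_insertI)
qed

lemma rtrancl_leaf:
  assumes iso: "\<forall>e\<in>X. \<not> incident i e" and e: "e = (i, b) \<or> e = (b, i)"
    and "b \<noteq> i" "s \<noteq> i"
  shows "(i, s) \<in> (undirected (insert e X))\<^sup>* \<longleftrightarrow> (b, s) \<in> (undirected X)\<^sup>*"
proof -
  have ib: "(i, b) \<in> undirected (insert e X)" "(b, i) \<in> undirected (insert e X)"
    by (auto simp: undirected_insert[OF e])
  then have "(i, s) \<in> (undirected (insert e X))\<^sup>* \<longleftrightarrow> (b, s) \<in> (undirected (insert e X))\<^sup>*"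
    by (meson converse_rtrancl_into_rtrancl)
  then show ?thesis using rtrancl_insert_leaf[OF iso e] assms by simp
qed

text \<open>Without its only edge, \<open>i\<close> is isolated and has to become a root itself; as
  such it serves no other vertex. This is the recursion step shared by the forests and the
  minors.\<close>

lemma reaches_insert_leaf:
  assumes iso: "\<forall>e\<in>X. \<not> incident i e" and e: "e = (i, b) \<or> e = (b, i)"
    and b: "b \<noteq> i" "b \<in> V" and i: "i \<in> V" "i \<notin> S"
  shows "reaches V S (insert e X) \<longleftrightarrow> reaches V (insert i S) X"
proof
  assume L: "reaches V S (insert e X)"
  show "reaches V (insert i S) X"
    unfolding reaches_def
  proof
    fix u assume u: "u \<in> V"
    show "\<exists>s\<in>insert i S. (u, s) \<in> (undirected X)\<^sup>*"
    proof (cases "u = i")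
      case False
      with L u obtain s where "s \<in> S" "(u, s) \<in> (undirected (insert e X))\<^sup>*"
        by (auto simp: reaches_def)
      then show ?thesis using rtrancl_insert_leaf[OF iso e False, of s] i by auto
    qed auto
  qed
next
  assume R: "reaches V (insert i S) X"
  have *: "\<exists>s\<in>S. (u, s) \<in> (undirected X)\<^sup>*" if "u \<in> V" "u \<noteq> i" for u
    using R that rtrancl_isolated[OF iso] by (fastforce simp: reaches_def)
  show "reaches V S (insert e X)"
    unfolding reaches_def
  proof
    fix u assume u: "u \<in> V"
    show "\<exists>s\<in>S. (u, s) \<in> (undirected (insert e X))\<^sup>*"
    proof (cases "u = i")
      case True
      obtain s where "s \<in> S" "(b, s) \<in> (undirected X)\<^sup>*" using *[OF b(2,1)] by blast
      then show ?thesis using rtrancl_leaf[OF iso e b(1), of s] i True by metis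
    next
      case False
      obtain s where "s \<in> S" "(u, s) \<in> (undirected X)\<^sup>*" using *[OF u False] by blast
      then show ?thesis using rtrancl_insert_leaf[OF iso e False, of s] i by metis
    qed
  qed
qed

text \<open>Count incidences twice. If every vertex of \<open>R\<close> has degree at least 2, the
  total is at least \<open>2 * card R\<close>; each edge contributes at most 2, and an edge with an
  end outside \<open>R\<close> less, so the total falls below \<open>2 * card T\<close>. The
  indexing by \<open>e\<close> allows edge sets as well as sets of columns.\<close>

lemma leaf_trichotomy:
  assumes fin: "finite T" "finite R" and card: "card T \<le> card R"
    and loopfree: "\<And>c. c \<in> T \<Longrightarrow> fst (e c) \<noteq> snd (e c)"
  shows "(\<exists>i\<in>R. \<forall>c\<in>T. \<not> incident i (e c))
    \<or> (\<exists>i\<in>R. \<exists>c\<in>T. incident i (e c) \<and> (\<forall>d\<in>T. d \<noteq> c \<longrightarrow> \<not> incident i (e d)))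
    \<or> (\<forall>c\<in>T. fst (e c) \<in> R \<and> snd (e c) \<in> R)"
proof (rule ccontr)
  assume contr: "\<not> ?thesis"
  let ?D = "\<lambda>i. T \<inter> {c. incident i (e c)}"
  have deg_pos: "\<exists>c\<in>T. incident i (e c)" if "i \<in> R" for i
    using contr that by simp
  have no_leaf: "\<exists>d\<in>T. d \<noteq> c \<and> incident i (e d)" if "i \<in> R" "c \<in> T" "incident i (e c)" for i c
    using contr that by auto
  have deg: "2 \<le> card (?D i)" if i: "i \<in> R" for i
  proof -
    obtain c where c: "c \<in> ?D i" using deg_pos[OF i] by blast
    moreover obtain d where d: "d \<in> ?D i" "d \<noteq> c" using no_leaf[OF i] c by blast
    ultimately have "card {c, d} \<le> card (?D i)" using fin by (intro card_mono) auto
    then show ?thesis using d by simp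
  qed
  have ends: "(\<Sum>i\<in>R. of_bool (incident i (e c)))
      = of_bool (fst (e c) \<in> R) + (of_bool (snd (e c) \<in> R) :: nat)" if "c \<in> T" for c
  proof -
    have "(\<Sum>i\<in>R. of_bool (incident i (e c)))
        = (\<Sum>i\<in>R. of_bool (i = fst (e c)) + (of_bool (i = snd (e c)) :: nat))"
      using loopfree[OF that] by (intro sum.cong) (auto simp: incident_def)
    then show ?thesis using fin by (simp add: sum.distrib of_bool_def)
  qed
  obtain c0 where c0: "c0 \<in> T" "\<not> (fst (e c0) \<in> R \<and> snd (e c0) \<in> R)"
    using contr by auto
  have "2 * card R = (\<Sum>i\<in>R. 2)" by simp
  also have "\<dots> \<le> (\<Sum>i\<in>R. card (?D i))" by (intro sum_mono deg)
  also have "\<dots> = (\<Sum>i\<in>R. \<Sum>c\<in>T. of_bool (incident i (e c)))"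
    using fin by simp
  also have "\<dots> = (\<Sum>c\<in>T. of_bool (fst (e c) \<in> R) + of_bool (snd (e c) \<in> R))"
    by (subst sum.swap) (intro sum.cong refl ends)
  also have "\<dots> < (\<Sum>c\<in>T. 2)"
    using c0 fin by (intro sum_strict_mono_ex1) auto
  finally show False using card by simp
qed

lemma reaches_imp_not_isolated:
  assumes "reaches V S X" "i \<in> V" "i \<notin> S"
  shows "\<exists>e\<in>X. incident i e"
proof (rule ccontr)
  assume "\<not> ?thesis"
  then have iso: "\<forall>e\<in>X. \<not> incident i e" by blast
  obtain s where "s \<in> S" "(i, s) \<in> (undirected X)\<^sup>*"
    using assms by (auto simp: reaches_def)
  then show False using rtrancl_isolated(2)[OF iso, of s] assms(3) by simp
qed

text \<open>A path that starts in \<open>R\<close> leaves it only along an edge with an end outside.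
  This rules out the third case of \<open>leaf_trichotomy\<close>.\<close>

lemma reaches_imp_crossing_edge:
  assumes "reaches V S X" "R \<subseteq> V" "R \<inter> S = {}" "R \<noteq> {}"
  shows "\<exists>e\<in>X. \<not> (fst e \<in> R \<and> snd e \<in> R)"
proof (rule ccontr)
  assume inside: "\<not> ?thesis"
  obtain u where "u \<in> R" using assms(4) by blast
  moreover from this obtain s where "s \<in> S" "(u, s) \<in> (undirected X)\<^sup>*"
    using assms(1,2) unfolding reaches_def by blast
  ultimately have u: "u \<in> R" "s \<in> S" "(u, s) \<in> (undirected X)\<^sup>*" .
  from u(3,1) have "s \<in> R"
    by (induction rule: rtrancl_induct) (use inside in \<open>auto simp: undirected_def\<close>)
  then show False using u assms by auto
qed

text \<open>On a cycle of length at least 3 every vertex has two distinct neighbours, but the only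
  neighbour of \<open>i\<close> is \<open>b\<close>.\<close>

lemma cycle_free_insert_leaf:
  assumes iso: "\<forall>e\<in>X. \<not> incident i e" and e: "e = (i, b) \<or> e = (b, i)"
    and b: "b \<noteq> i" and cf: "cycle_free X"
  shows "cycle_free (insert e X)"
  unfolding cycle_free_def
proof
  assume "\<exists>p. 3 \<le> length p \<and> distinct p \<and>
    (\<forall>k<length p. (p ! k, p ! (Suc k mod length p)) \<in> undirected (insert e X))"
  then obtain p where p: "3 \<le> length p" "distinct p"
    and cyc: "\<And>k. k < length p \<Longrightarrow> (p ! k, p ! (Suc k mod length p)) \<in> undirected (insert e X)"
    by blast
  let ?n = "length p"
  have old: "(x, y) \<in> undirected X" if "(x, y) \<in> undirected (insert e X)" "x \<noteq> i" "y \<noteq> i" for x y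
    using that by (auto simp: undirected_insert[OF e])
  have nbr: "y = b" if "(i, y) \<in> undirected (insert e X) \<or> (y, i) \<in> undirected (insert e X)" for y
    using that not_incident_undirected[OF iso] by (auto simp: undirected_insert[OF e])
  show False
  proof (cases "i \<in> set p")
    case False
    then have "p ! k \<noteq> i" if "k < ?n" for k using that nth_mem by metis
    then have "(p ! k, p ! (Suc k mod ?n)) \<in> undirected X" if "k < ?n" for k
      using that mod_less_divisor[of ?n "Suc k"] p(1) by (intro old cyc) fastforce+
    then show False using cf p by (auto simp: cycle_free_def)
  next
    case True
    then obtain k where k: "k < ?n" "p ! k = i" by (auto simp: in_set_conv_nth)
    \<comment> \<open>The cyclic predecessor of position \<open>k\<close>.\<close>
    define m where "m = (if k = 0 then ?n - 1 else k - 1)"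
    have m: "m < ?n" "Suc m mod ?n = k" using k p by (auto simp: m_def)
    have "p ! (Suc k mod ?n) = b" using cyc[OF k(1)] k(2) nbr by metis
    moreover have "p ! m = b" using cyc[OF m(1)] m(2) k(2) nbr by metis
    ultimately have "Suc k mod ?n = m"
      using p m(1) k by (metis mod_less_divisor not_less_zero nth_eq_iff_index_eq linorder_neqE_nat)
    then show False using k p by (auto simp: m_def mod_Suc split: if_splits)
  qed
qed

text \<open>Deleting the new edge leaves \<open>b\<close> connected to an old root and
  \<open>i\<close> isolated, so the edge points from \<open>i\<close> to \<open>b\<close>. For an
  old edge nothing changes: neither the pendant edge nor the extra root \<open>i\<close> helps any
  vertex other than \<open>i\<close>.\<close>

lemma orient_towards_insert_leaf:
  assumes iso: "\<forall>e\<in>X. \<not> incident i e" and e: "e = (i, b) \<or> e = (b, i)"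
    and b: "b \<noteq> i" "b \<in> V" and i: "i \<in> V" "i \<notin> S"
    and reach: "reaches V (insert i S) X"
  shows "orient_towards S (insert e X) = insert (i, b) (orient_towards (insert i S) X)"
proof -
  have "(x, y) \<in> orient_towards S (insert e X)
      \<longleftrightarrow> (x, y) \<in> insert (i, b) (orient_towards (insert i S) X)" for x y
  proof -
    consider "(x, y) \<in> undirected X" | "(x, y) = (i, b)" | "(x, y) = (b, i)"
      | "(x, y) \<notin> undirected (insert e X)"
      by (auto simp: undirected_insert[OF e])
    then show ?thesis
    proof cases
      case 1
      let ?Y = "X - {(x, y), (y, x)}"
      note xy = not_incident_undirected[OF iso 1]
      have iso': "\<forall>e\<in>?Y. \<not> incident i e" using iso by auto
      have "insert e X - {(x, y), (y, x)} = insert e ?Y" using e xy by auto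
      moreover have "s \<in> S \<and> (y, s) \<in> (undirected (insert e ?Y))\<^sup>*
          \<longleftrightarrow> s \<in> insert i S \<and> (y, s) \<in> (undirected ?Y)\<^sup>*" for s
        using rtrancl_insert_leaf[OF iso' e xy(2), of s] rtrancl_isolated(1)[OF iso', of y] xy(2) i(2)
        by (cases "s = i") auto
      then have "(\<exists>s\<in>S. (y, s) \<in> (undirected (insert e ?Y))\<^sup>*)
          \<longleftrightarrow> (\<exists>s\<in>insert i S. (y, s) \<in> (undirected ?Y)\<^sup>*)"
        by blast
      ultimately show ?thesis
        using 1 xy by (auto simp: orient_towards_def undirected_insert[OF e])
    next
      case 2
      have "insert e X - {(i, b), (b, i)} = X" using e iso by (auto simp: incident_def)
      moreover have "\<exists>s\<in>S. (b, s) \<in> (undirected X)\<^sup>*"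
        using reach b rtrancl_isolated[OF iso] by (fastforce simp: reaches_def)
      ultimately show ?thesis using 2 by (auto simp: orient_towards_def undirected_insert[OF e])
    next
      case 3
      have "insert e X - {(b, i), (i, b)} = X" using e iso by (auto simp: incident_def)
      then show ?thesis using 3 b i not_incident_undirected[OF iso, of b i] rtrancl_isolated[OF iso]
        by (auto simp: orient_towards_def)
    next
      case 4
      then show ?thesis by (auto simp: orient_towards_def undirected_insert[OF e])
    qed
  qed
  then show ?thesis by auto
qed

lemma finite_orient_towards: "finite X \<Longrightarrow> finite (orient_towards S X)"
  by (rule finite_subset[of _ "undirected X"]) (auto simp: orient_towards_def undirected_def)

text \<open>Induction on the number of non-roots. Reachability excludes two cases of
  \<open>leaf_trichotomy\<close>, so some non-root \<open>i\<close> has exactly one edge; remove it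
  and promote \<open>i\<close> to a root. The removed edge leaves \<open>i\<close>, which accounts
  for the factor \<open>\<alpha> i\<close>.\<close>

lemma reaches_imp_spanning_forest:
  assumes "finite V" "S \<subseteq> V" "X \<subseteq> V \<times> V" "\<And>e. e \<in> X \<Longrightarrow> fst e \<noteq> snd e"
    and "card X = card V - card S" "reaches V S X"
  shows "cycle_free X \<and> (\<forall>u\<in>V. \<exists>!s. s \<in> S \<and> (u, s) \<in> (undirected X)\<^sup>*)
    \<and> forest_weight \<alpha> (orient_towards S X) = (\<Prod>i\<in>V - S. \<alpha> i)"
  using assms
proof (induction "card (V - S)" arbitrary: S X)
  case 0
  then have S: "S = V" by auto
  have "finite X" using 0 by (meson finite_SigmaI finite_subset)
  then have X: "X = {}" using 0 S by simp
  have "\<not> (\<exists>p :: 'a list. 3 \<le> length p \<and> distinct p \<and> (\<forall>i<length p. False))" by (auto intro: exI[of _ 0])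
  then show ?case by (auto simp: S X cycle_free_def undirected_def orient_towards_def forest_weight_def)
next
  case (Suc n)
  let ?R = "V - S"
  have fin: "finite X" "finite ?R" using Suc.prems by (meson finite_SigmaI finite_subset finite_Diff)+
  have cardR: "card X = card ?R"
    using Suc.prems by (simp add: card_Diff_subset finite_subset)
  have "?R \<noteq> {}" using Suc.hyps(2) by (metis card.empty nat.distinct(1))
  then have "\<not> (\<forall>e\<in>X. fst e \<in> ?R \<and> snd e \<in> ?R)"
    using reaches_imp_crossing_edge[OF Suc.prems(6), of ?R] by blast
  moreover have "\<not> (\<exists>i\<in>?R. \<forall>e\<in>X. \<not> incident i e)"
    using reaches_imp_not_isolated[OF Suc.prems(6)] by blast
  ultimately obtain i e where ie: "i \<in> ?R" "e \<in> X" "incident i e" "\<forall>d\<in>X. d \<noteq> e \<longrightarrow> \<not> incident i d"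
    using leaf_trichotomy[OF fin, of "\<lambda>e. e"] cardR Suc.prems(4) by auto
  define Y where "Y = X - {e}"
  have X: "X = insert e Y" "e \<notin> Y" using ie by (auto simp: Y_def)
  have iso: "\<forall>d\<in>Y. \<not> incident i d" using ie by (auto simp: Y_def)
  obtain b where e: "e = (i, b) \<or> e = (b, i)" using ie(3) by (cases e) (auto simp: incident_def)
  have b: "b \<noteq> i" "b \<in> V" using e ie(2) Suc.prems(3,4) by force+
  have i: "i \<in> V" "i \<notin> S" using ie by auto
  have reach: "reaches V (insert i S) Y"
    using reaches_insert_leaf[OF iso e b i] Suc.prems(6) X by simp
  have "card (V - insert i S) = n" 
    using Suc.hyps(2) fin i by (metis Diff_insert card_Diff_singleton diff_Suc_1 ie(1))
  moreover have "card Y = card V - card (insert i S)"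
    using Suc.prems fin i cardR unfolding Y_def
    by (simp add: ie(2) finite_subset)
  ultimately have IH: "cycle_free Y" "\<forall>u\<in>V. \<exists>!s. s \<in> insert i S \<and> (u, s) \<in> (undirected Y)\<^sup>*"
    "forest_weight \<alpha> (orient_towards (insert i S) Y) = (\<Prod>i\<in>V - insert i S. \<alpha> i)"
    using Suc.hyps(1)[of "insert i S" Y] Suc.prems i reach by (auto simp: Y_def)
  have "cycle_free X" unfolding X using cycle_free_insert_leaf[OF iso e b(1) IH(1)] .
  moreover have "\<exists>!s. s \<in> S \<and> (u, s) \<in> (undirected X)\<^sup>*" if u: "u \<in> V" for u
  proof -
    \<comment> \<open>The pendant vertex inherits its root from its neighbour
      \<open>b\<close>.\<close>
    let ?u = "if u = i then b else u"
    have u': "?u \<in> V" "?u \<noteq> i" using u b by auto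
    have "(?u, i) \<notin> (undirected Y)\<^sup>*" using rtrancl_isolated(1)[OF iso, of ?u] u' by simp
    moreover have "(u, s) \<in> (undirected X)\<^sup>* \<longleftrightarrow> (?u, s) \<in> (undirected Y)\<^sup>*" if "s \<in> S" for s
    proof -
      have "s \<noteq> i" using that i by auto
      then show ?thesis unfolding X
        using rtrancl_insert_leaf[OF iso e, of u s] rtrancl_leaf[OF iso e b(1), of s] by simp
    qed
    ultimately have "s \<in> S \<and> (u, s) \<in> (undirected X)\<^sup>*
        \<longleftrightarrow> s \<in> insert i S \<and> (?u, s) \<in> (undirected Y)\<^sup>*" for s
      using i by blast
    then show ?thesis using IH(2)[rule_format, OF u'(1)] by simp
  qed
  moreover have "forest_weight \<alpha> (orient_towards S X) = (\<Prod>i\<in>V - S. \<alpha> i)"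
  proof -
    have notin: "(i, b) \<notin> orient_towards (insert i S) Y"
      using not_incident_undirected[OF iso, of i b] by (auto simp: orient_towards_def)
    have "finite Y" using fin by (simp add: Y_def)
    then have "forest_weight \<alpha> (orient_towards S X) = \<alpha> i * (\<Prod>i\<in>V - insert i S. \<alpha> i)"
      unfolding X orient_towards_insert_leaf[OF iso e b i reach] IH(3)[symmetric] forest_weight_def
      using notin by (subst prod.insert) (auto intro: finite_orient_towards)
    also have "\<dots> = (\<Prod>i\<in>V - S. \<alpha> i)"
      using fin i by (metis Diff_insert ie(1) prod.remove)
    finally show ?thesis .
  qed
  ultimately show ?case by blast
qed

section \<open>Principal minors\<close>

text \<open>The Leibniz sum of the principal submatrix on \<open>U\<close>. Summing over
  permutations of \<open>U\<close> itself avoids renumbering the indices.\<close>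

definition pminor :: "(nat \<Rightarrow> nat \<Rightarrow> 'a :: comm_ring_1) \<Rightarrow> nat set \<Rightarrow> 'a" where
  "pminor N U = (\<Sum>p | p permutes U. signof p * (\<Prod>i\<in>U. N i (p i)))"

lemma pminor_empty [simp]: "pminor N {} = 1"
  by (simp add: pminor_def)

text \<open>The extra factors annihilate every permutation that moves a point outside
  \<open>U\<close>; the remaining ones are the permutations of \<open>U\<close>. A common range of
  permutations for all \<open>U\<close> is what lets sums be interchanged.\<close>

lemma pminor_altdef:
  assumes fin: "finite A" and U: "U \<subseteq> A"
  shows "pminor N U = (\<Sum>p | p permutes A.
    signof p * ((\<Prod>i\<in>U. N i (p i)) * (\<Prod>i\<in>A - U. of_bool (p i = i))))"
proof -
  have "(\<Sum>p | p permutes A. signof p * ((\<Prod>i\<in>U. N i (p i)) * (\<Prod>i\<in>A - U. of_bool (p i = i))))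
      = (\<Sum>p | p permutes U. signof p * ((\<Prod>i\<in>U. N i (p i)) * (\<Prod>i\<in>A - U. of_bool (p i = i))))"
  proof (rule sum.mono_neutral_right)
    show "finite {p. p permutes A}" using fin by (rule finite_permutations)
    show "{p. p permutes U} \<subseteq> {p. p permutes A}" using permutes_subset U by blast
    show "\<forall>p\<in>{p. p permutes A} - {p. p permutes U}.
        signof p * ((\<Prod>i\<in>U. N i (p i)) * (\<Prod>i\<in>A - U. of_bool (p i = i))) = 0"
    proof
      fix p assume p: "p \<in> {p. p permutes A} - {p. p permutes U}"
      then have "\<exists>i\<in>A - U. p i \<noteq> i" using permutes_superset by blast
      then have "(\<Prod>i\<in>A - U. of_bool (p i = i)) = (0 :: 'a)"
        using fin by (auto intro!: prod_zero)
      then show "signof p * ((\<Prod>i\<in>U. N i (p i)) * (\<Prod>i\<in>A - U. of_bool (p i = i))) = 0" by simp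
    qed
  qed
  also have "\<dots> = pminor N U"
    unfolding pminor_def by (intro sum.cong refl) (auto simp: permutes_not_in)
  finally show ?thesis ..
qed

text \<open>Multiply out each Leibniz product, with \<open>U\<close> the set of rows where the
  summand from \<open>N\<close> is chosen; a row that takes \<open>d\<close> requires a fixed
  point.\<close>

lemma det_add_diag:
  fixes N :: "nat \<Rightarrow> nat \<Rightarrow> 'a :: comm_ring_1"
  shows "det (mat n n (\<lambda>(i, j). N i j + (if i = j then d i else 0)))
    = (\<Sum>U\<in>Pow {0..<n}. pminor N U * (\<Prod>i\<in>{0..<n} - U. d i))"
proof -
  let ?A = "{0..<n}" and ?P = "{p. p permutes {0..<n}}"
  let ?b = "\<lambda>p i. of_bool (p i = i) :: 'a"
  have "det (mat n n (\<lambda>(i, j). N i j + (if i = j then d i else 0)))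
      = (\<Sum>p\<in>?P. signof p * (\<Prod>i\<in>?A. N i (p i) + ?b p i * d i))"
    unfolding det_def by (auto intro!: sum.cong prod.cong arg_cong2[of _ _ _ _ "(*)"])
  also have "\<dots> = (\<Sum>p\<in>?P. \<Sum>U\<in>Pow ?A.
      signof p * ((\<Prod>i\<in>U. N i (p i)) * (\<Prod>i\<in>?A - U. ?b p i)) * (\<Prod>i\<in>?A - U. d i))"
    by (simp add: prod_add sum_distrib_left prod.distrib mult.assoc)
  also have "\<dots> = (\<Sum>U\<in>Pow ?A. (\<Sum>p\<in>?P.
      signof p * ((\<Prod>i\<in>U. N i (p i)) * (\<Prod>i\<in>?A - U. ?b p i))) * (\<Prod>i\<in>?A - U. d i))"
    by (subst sum.swap) (simp add: sum_distrib_right)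
  also have "\<dots> = (\<Sum>U\<in>Pow ?A. pminor N U * (\<Prod>i\<in>?A - U. d i))"
    by (intro sum.cong refl) (simp add: pminor_altdef[symmetric])
  finally show ?thesis .
qed

text \<open>Unit rows outside \<open>U\<close> force fixed points there. This makes criteria for
  \<open>det\<close> available for minors.\<close>

lemma pminor_eq_det:
  assumes "U \<subseteq> {0..<n}"
  shows "pminor N U
    = det (mat n n (\<lambda>(i, j). if i \<in> U then N i j else if i = j then 1 else 0))"
proof -
  let ?A = "{0..<n}"
  have "det (mat n n (\<lambda>(i, j). if i \<in> U then N i j else if i = j then 1 else 0))
      = (\<Sum>p | p permutes ?A. signof p * (\<Prod>i\<in>?A. if i \<in> U then N i (p i) else of_bool (p i = i)))"
    unfolding det_def by (auto intro!: sum.cong prod.cong arg_cong2[of _ _ _ _ "(*)"])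
  also have "\<dots> = (\<Sum>p | p permutes ?A.
      signof p * ((\<Prod>i\<in>U. N i (p i)) * (\<Prod>i\<in>?A - U. of_bool (p i = i))))"
    using assms by (simp add: prod.If_cases Int_absorb1 Diff_eq)
  finally show ?thesis using pminor_altdef[of ?A U N] assms by simp
qed

text \<open>The indicator vector of \<open>R\<close> is a nonzero kernel vector of the matrix in
  \<open>pminor_eq_det\<close>: on the unit rows it vanishes because \<open>R\<close> lies in
  \<open>U\<close>.\<close>

lemma pminor_kernel:
  fixes N :: "nat \<Rightarrow> nat \<Rightarrow> 'a :: idom"
  assumes "finite U" "R \<subseteq> U" "R \<noteq> {}" and ker: "\<And>i. i \<in> U \<Longrightarrow> (\<Sum>j\<in>R. N i j) = 0"
  shows "pminor N U = 0"
proof -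
  obtain n where n: "U \<subseteq> {0..<n}"
    using assms(1) by (metis atLeast0LessThan finite_nat_iff_bounded)
  let ?K = "mat n n (\<lambda>(i, j). if i \<in> U then N i j else if i = j then 1 else 0)"
  let ?v = "vec n (\<lambda>j. of_bool (j \<in> R)) :: 'a vec"
  have "?K *\<^sub>v ?v = 0\<^sub>v n"
  proof (rule eq_vecI)
    fix i assume "i < dim_vec (0\<^sub>v n :: 'a vec)"
    then have i: "i < n" by simp
    have RA: "{0..<n} \<inter> R = R" using assms n by auto
    have "(?K *\<^sub>v ?v) $ i
        = (\<Sum>j = 0..<n. ?K $$ (i, j) * of_bool (j \<in> R))"
      using i by (subst index_mult_mat_vec) (auto simp: scalar_prod_def intro: sum.cong)
    also have "\<dots> = (\<Sum>j = 0..<n. if j \<in> R then if i \<in> U then N i j else of_bool (i = j) else 0)"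
      using i by (intro sum.cong) auto
    also have "\<dots> = (\<Sum>j\<in>R. if i \<in> U then N i j else of_bool (i = j))"
      by (simp add: sum.inter_restrict[symmetric] RA)
    also have "\<dots> = 0"
    proof (cases "i \<in> U")
      case False
      then show ?thesis using assms(2) by (auto intro!: sum.neutral)
    qed (simp add: ker)
    finally show "(?K *\<^sub>v ?v) $ i = 0\<^sub>v n $ i" using i by simp
  qed simp
  moreover have "?v \<noteq> 0\<^sub>v n"
  proof
    assume eq: "?v = 0\<^sub>v n"
    obtain j where "j \<in> R" "j < n" using assms(2,3) n by (meson atLeastLessThan_iff ex_in_conv subsetD)
    then show False using arg_cong[OF eq, of "\<lambda>u. u $ j"] by simp
  qed
  ultimately show ?thesis
    unfolding pminor_eq_det[OF n] by (intro det_0_iff_vec_prod_zero[THEN iffD2] exI[of _ ?v] conjI) simp_all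
qed

section \<open>Vanishing and expansion of minors\<close>

lemma pminor_zero_row:
  assumes "finite U" "i \<in> U" "\<And>j. j \<in> U \<Longrightarrow> N i j = 0"
  shows "pminor N U = 0"
  unfolding pminor_def
proof (rule sum.neutral, rule ballI)
  fix p assume "p \<in> {p. p permutes U}"
  then have "N i (p i) = 0" using assms permutes_in_image by fastforce
  then show "signof p * (\<Prod>i\<in>U. N i (p i)) = 0" using assms by (metis mult_zero_right prod_zero)
qed

text \<open>A permutation with a nonzero term maps \<open>R\<close> into \<open>T\<close> and
  \<open>T\<close> into \<open>R\<close>, injectively, so the two sets would have equal
  size.\<close>

lemma pminor_bipartite_card:
  assumes fin: "finite R" "finite T" and disj: "R \<inter> T = {}" and card: "card R \<noteq> card T"
    and RR: "\<And>i j. i \<in> R \<Longrightarrow> j \<in> R \<Longrightarrow> N i j = 0"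
    and TT: "\<And>i j. i \<in> T \<Longrightarrow> j \<in> T \<Longrightarrow> N i j = 0"
  shows "pminor N (R \<union> T) = 0"
  unfolding pminor_def
proof (rule sum.neutral, rule ballI)
  fix p assume "p \<in> {p. p permutes R \<union> T}"
  then have p: "p permutes R \<union> T" by simp
  have "\<exists>i\<in>R \<union> T. N i (p i) = 0"
  proof (rule ccontr)
    assume "\<not> ?thesis"
    then have nz: "N i (p i) \<noteq> 0" if "i \<in> R \<union> T" for i using that by blast
    have RT: "p ` R \<subseteq> T"
    proof
      fix y assume "y \<in> p ` R"
      then obtain i where i: "i \<in> R" "y = p i" by auto
      then have "y \<in> R \<union> T" using permutes_in_image[OF p] by simp
      then show "y \<in> T" using RR[of i y] nz[of i] i by auto
    qed
    have TR: "p ` T \<subseteq> R"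
    proof
      fix y assume "y \<in> p ` T"
      then obtain i where i: "i \<in> T" "y = p i" by auto
      then have "y \<in> R \<union> T" using permutes_in_image[OF p] by simp
      then show "y \<in> R" using TT[of i y] nz[of i] i by auto
    qed
    show False
      using card_inj_on_le[OF permutes_inj_on[OF p] RT] card_inj_on_le[OF permutes_inj_on[OF p] TR]
        fin card by simp
  qed
  then show "signof p * (\<Prod>i\<in>R \<union> T. N i (p i)) = 0"
    using fin by (metis finite_UnI mult_zero_right prod_zero)
qed

text \<open>Row \<open>i\<close> forces \<open>p i = c\<close> and column \<open>i\<close> forces
  \<open>p c = i\<close> in every nonzero term. Composing with the transposition of \<open>i\<close>
  and \<open>c\<close> turns such a \<open>p\<close> into a permutation of the remaining indices and
  flips the sign.\<close>

lemma pminor_pendant: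
  fixes N :: "nat \<Rightarrow> nat \<Rightarrow> 'a :: comm_ring_1"
  assumes fin: "finite U" and ic: "i \<in> U" "c \<in> U" "i \<noteq> c"
    and row: "\<And>j. j \<in> U \<Longrightarrow> j \<noteq> c \<Longrightarrow> N i j = 0"
    and col: "\<And>j. j \<in> U \<Longrightarrow> j \<noteq> c \<Longrightarrow> N j i = 0"
  shows "pminor N U = - (N i c * N c i * pminor N (U - {i, c}))"
proof -
  let ?W = "U - {i, c}" and ?t = "transpose i c"
  have U: "U = insert i (insert c ?W)" using ic by auto
  have "pminor N U = (\<Sum>p | p permutes U \<and> p i = c \<and> p c = i. signof p * (\<Prod>j\<in>U. N j (p j)))"
    unfolding pminor_def
  proof (rule sum.mono_neutral_right)
    show "finite {p. p permutes U}" using fin by (rule finite_permutations)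
    show "\<forall>p\<in>{p. p permutes U} - {p. p permutes U \<and> p i = c \<and> p c = i}.
        signof p * (\<Prod>j\<in>U. N j (p j)) = 0"
    proof
      fix p assume p': "p \<in> {p. p permutes U} - {p. p permutes U \<and> p i = c \<and> p c = i}"
      then have p: "p permutes U" by simp
      have "\<exists>j\<in>U. N j (p j) = 0"
      proof (cases "p i = c")
        case False
        then show ?thesis using row ic(1) permutes_in_image[OF p] by blast
      next
        case True
        then have "p c \<noteq> i" using p' by blast
        \<comment> \<open>This preimage of \<open>i\<close> differs from \<open>c\<close>, so its
          entry lies in the vanishing part of column \<open>i\<close>.\<close>
        moreover obtain j where "p j = i" using permutes_surj[OF p] by (metis surj_def)
        ultimately show ?thesis using col permutes_in_image[OF p] ic(1) by metis
      qed
      then show "signof p * (\<Prod>j\<in>U. N j (p j)) = 0" using fin by (metis mult_zero_right prod_zero)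
    qed
  qed auto
  also have "\<dots> = (\<Sum>q | q permutes ?W. signof (?t \<circ> q) * (\<Prod>j\<in>U. N j ((?t \<circ> q) j)))"
  proof (rule sum.reindex_bij_witness[of _ "\<lambda>q. ?t \<circ> q" "\<lambda>p. ?t \<circ> p"])
    fix p assume "p \<in> {p. p permutes U \<and> p i = c \<and> p c = i}"
    then have p: "p permutes U" "p i = c" "p c = i" by auto
    show "?t \<circ> (?t \<circ> p) = p" by (auto simp: fun_eq_iff)
    then show "signof (?t \<circ> (?t \<circ> p)) * (\<Prod>j\<in>U. N j ((?t \<circ> (?t \<circ> p)) j))
        = signof p * (\<Prod>j\<in>U. N j (p j))" by simp
    have "?t \<circ> p permutes U" using p ic by (intro permutes_compose permutes_swap_id)
    then have "?t \<circ> p permutes ?W" by (rule permutes_superset) (use p in auto)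
    then show "?t \<circ> p \<in> {q. q permutes ?W}" by simp
  next
    fix q assume "q \<in> {q. q permutes ?W}"
    then have q: "q permutes ?W" by simp
    show "?t \<circ> (?t \<circ> q) = q" by (auto simp: fun_eq_iff)
    have "q permutes U" using q by (rule permutes_subset) auto
    then have "?t \<circ> q permutes U" using ic by (intro permutes_compose permutes_swap_id)
    then show "?t \<circ> q \<in> {p. p permutes U \<and> p i = c \<and> p c = i}"
      using q by (auto simp: permutes_not_in)
  qed
  also have "\<dots> = (\<Sum>q | q permutes ?W. - (N i c * N c i * (signof q * (\<Prod>j\<in>?W. N j (q j)))))"
  proof (rule sum.cong[OF refl])
    fix q assume "q \<in> {q. q permutes ?W}"
    then have q: "q permutes ?W" by simp
    have "permutation q" using q fin by (auto simp: permutation_permutes)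
    then have sgn: "sign (?t \<circ> q) = - sign q"
      using ic by (simp add: sign_compose permutation_swap_id sign_swap_id)
    have rest: "?t (q j) = q j" if "j \<in> ?W" for j
      using permutes_in_image[OF q, of j] that by (auto simp: transpose_def)
    have "(\<Prod>j\<in>U. N j ((?t \<circ> q) j)) = N i c * (N c i * (\<Prod>j\<in>?W. N j (q j)))"
      by (subst U) (use fin ic q rest in \<open>simp add: permutes_not_in\<close>)
    then show "signof (?t \<circ> q) * (\<Prod>j\<in>U. N j ((?t \<circ> q) j))
        = - (N i c * N c i * (signof q * (\<Prod>j\<in>?W. N j (q j))))"
      by (simp add: sgn mult_ac)
  qed
  also have "\<dots> = - (N i c * N c i * pminor N ?W)"
    by (simp add: pminor_def sum_distrib_left sum_negf)
  finally show ?thesis .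
qed

section \<open>Eigenvalues, pseudoinverse and rank\<close>

lemma char_poly_orthogonal_diag:
  assumes U: "U \<in> carrier_mat n n" and UU: "transpose_mat U * U = 1\<^sub>m n"
  shows "char_poly (U * mat_diag n f * transpose_mat U) = (\<Prod>i<n. [:- f i :: real, 1:])"
proof -
  have "U * transpose_mat U = 1\<^sub>m n"
    using mat_mult_left_right_inverse[OF _ U UU] U by simp
  then have "similar_mat (U * mat_diag n f * transpose_mat U) (mat_diag n f)"
    using U UU mult_carrier_mat[OF mult_carrier_mat[OF U mat_diag_dim[of n f]], of "transpose_mat U" n]
    by (intro similar_matI[of _ _ U "transpose_mat U" n]) auto
  then have "char_poly (U * mat_diag n f * transpose_mat U) = char_poly (mat_diag n f)"
    by (rule char_poly_similar)
  also have "\<dots> = (\<Prod>a\<leftarrow>diag_mat (mat_diag n f). [:- a, 1:])"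
    by (rule char_poly_upper_triangular[of _ n]) (auto simp: mat_diag_def)
  also have "diag_mat (mat_diag n f) = map f [0..<n]"
    by (auto simp: diag_mat_def mat_diag_def)
  also have "(\<Prod>a\<leftarrow>map f [0..<n]. [:- a, 1:]) = (\<Prod>i<n. [:- f i, 1:])"
    by (simp add: o_def interv_sum_list_conv_sum_set_nat prod.distinct_set_conv_list[symmetric] atLeast0LessThan)
  finally show ?thesis .
qed

lemma proots_prod_linear:
  fixes f :: "nat \<Rightarrow> real"
  shows "proots (\<Prod>i<n. [:- f i, 1:]) = image_mset f (mset_set {..<n})"
proof -
  have "proots (\<Prod>i<n. [:- f i, 1:]) = (\<Sum>i<n. {#f i#})"
    by (subst proots_prod) auto
  then show ?thesis by (simp add: sum_unfold_sum_mset)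
qed

text \<open>The zero eigenvalues come last, since all the others are positive.\<close>

lemma prod_eig_nonneg:
  fixes f :: "nat \<Rightarrow> real"
  assumes cp: "proots (char_poly A) = image_mset f (mset_set {..<n})"
    and nonneg: "\<And>i. i < n \<Longrightarrow> f i \<ge> 0"
    and r: "card {i. i < n \<and> f i \<noteq> 0} = r"
  shows "(\<Prod>j = 1..r. eig j A) = (\<Prod>i | i < n \<and> f i \<noteq> 0. f i)"
proof -
  let ?M = "image_mset f (mset_set {..<n})"
  let ?I = "{i. i < n \<and> f i \<noteq> 0}"
  define P where "P = sorted_list_of_multiset (filter_mset (\<lambda>x. x \<noteq> 0) ?M)"
  define Z where "Z = replicate (count ?M 0) (0 :: real)"
  have filt: "filter_mset (\<lambda>x. x \<noteq> 0) ?M = image_mset f (mset_set ?I)"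
    by (simp add: filter_mset_image_mset)
  have "sorted (Z @ P)"
    using nonneg by (auto simp: sorted_append Z_def P_def sorted_replicate)
  moreover have "mset (Z @ P) = ?M"
  proof -
    have "filter_mset (\<lambda>x. \<not> x \<noteq> 0) ?M = replicate_mset (count ?M 0) 0"
      by (simp add: filter_eq_replicate_mset)
    then have "?M = filter_mset (\<lambda>x. x \<noteq> 0) ?M + replicate_mset (count ?M 0) 0"
      using multiset_partition[of ?M "\<lambda>x. x \<noteq> 0"] by argo
    moreover have "mset (Z @ P) = replicate_mset (count ?M 0) 0 + filter_mset (\<lambda>x. x \<noteq> 0) ?M"
      by (simp add: Z_def P_def)
    ultimately show ?thesis by (metis add.commute)
  qed
  ultimately have "sorted_list_of_multiset ?M = Z @ P"
    by (metis sorted_list_of_multiset_mset sorted_sort_id)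
  then have eigs: "eigenvalues_decr A = rev P @ Z"
    by (simp add: eigenvalues_decr_def cp Z_def)
  have len: "length P = r"
  proof -
    have "length P = size (mset P)" by simp
    also have "mset P = image_mset f (mset_set ?I)" by (simp only: P_def mset_sorted_list_of_multiset filt)
    finally show ?thesis using r by simp
  qed
  have "(\<Prod>j = 1..r. eig j A) = (\<Prod>j<r. rev P ! j)"
  \<comment> \<open>\<open>eig\<close> counts from 1, list positions from 0.\<close>
  proof (rule prod.reindex_bij_witness[of _ Suc "\<lambda>j. j - 1"])
    fix j assume "j \<in> {1..r}"
    then have "j - 1 < length (rev P)" using len by auto
    then show "rev P ! (j - 1) = eig j A" by (simp only: eig_def eigs nth_append if_True)
  qed auto
  also have "\<dots> = prod_list (rev P)"
    using len by (simp only: prod.list_conv_set_nth length_rev atLeast0LessThan)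
  also have "\<dots> = prod_mset (mset P)" by (simp only: prod_mset_prod_list[symmetric] mset_rev)
  also have "\<dots> = (\<Prod>i\<in>?I. f i)" by (simp add: P_def filt prod_unfold_prod_mset)
  finally show ?thesis .
qed

section \<open>The pseudoinverse of an orthogonally diagonalized matrix\<close>

lemma orthogonal_diag_mult:
  fixes U :: "real mat"
  assumes U: "U \<in> carrier_mat n n" and UU: "transpose_mat U * U = 1\<^sub>m n"
  shows "(U * mat_diag n f * transpose_mat U) * (U * mat_diag n g * transpose_mat U)
    = U * mat_diag n (\<lambda>i. f i * g i) * transpose_mat U"
proof -
  let ?T = "transpose_mat U"
  have T: "?T \<in> carrier_mat n n" using U by simp
  have D: "mat_diag n h \<in> carrier_mat n n" for h :: "nat \<Rightarrow> real" by simp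
  note c = mult_carrier_mat[of _ n n _ n]
  have "(U * mat_diag n f * ?T) * (U * mat_diag n g * ?T)
      = U * mat_diag n f * (?T * (U * (mat_diag n g * ?T)))"
    using U T D[of f] D[of g] by (simp add: assoc_mult_mat[of _ n n _ n _ n] c[OF D T] c[OF U D])
  also have "?T * (U * (mat_diag n g * ?T)) = (?T * U) * (mat_diag n g * ?T)"
    using assoc_mult_mat[OF T U c[OF D T]] by simp
  also have "\<dots> = mat_diag n g * ?T" unfolding UU by (rule left_mult_one_mat[OF c[OF D[of g] T]])
  also have "U * mat_diag n f * (mat_diag n g * ?T) = U * (mat_diag n f * mat_diag n g) * ?T"
    using assoc_mult_mat[OF c[OF U D] D T, of f g] assoc_mult_mat[OF U D D, of f g] by simp
  finally show ?thesis by simp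
qed

lemma orthogonal_diag_sym:
  fixes U :: "real mat"
  assumes U: "U \<in> carrier_mat n n"
  shows "transpose_mat (U * mat_diag n f * transpose_mat U) = U * mat_diag n f * transpose_mat U"
proof -
  have D: "mat_diag n f \<in> carrier_mat n n" by simp
  have T: "transpose_mat U \<in> carrier_mat n n" using U by simp
  have "transpose_mat (mat_diag n f) = mat_diag n f" by (rule eq_matI) (auto simp: mat_diag_def)
  then show ?thesis
    using transpose_mult[OF mult_carrier_mat[OF U D] T] transpose_mult[OF U D] assoc_mult_mat[OF U D T]
    by simp
qed

text \<open>Penrose's argument: \<open>A * X = (A * Y) * (A * X)\<close>, and transposing symmetric
  factors reverses them, so \<open>A * X = (A * X) * (A * Y) = A * Y\<close>. Likewise
  \<open>X * A = Y * A\<close>, whence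
  \<open>X = X * A * X = X * A * Y = Y * A * Y = Y\<close>.\<close>

lemma is_pseudoinverse_unique:
  assumes X: "is_pseudoinverse A X" and Y: "is_pseudoinverse A Y"
  shows "X = Y"
proof -
  let ?m = "dim_row A" and ?n = "dim_col A"
  have c: "A \<in> carrier_mat ?m ?n" "X \<in> carrier_mat ?n ?m" "Y \<in> carrier_mat ?n ?m"
    using X Y by (auto simp: is_pseudoinverse_def)
  note m = mult_carrier_mat[OF c(1) c(2)] mult_carrier_mat[OF c(1) c(3)]
    mult_carrier_mat[OF c(2) c(1)] mult_carrier_mat[OF c(3) c(1)]
  have AX: "A * X = A * Y"
  proof -
    have "A * X = (A * Y) * (A * X)"
      using Y assoc_mult_mat[OF m(2) c(1,2)] by (simp add: is_pseudoinverse_def)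
    then have "transpose_mat (A * X) = transpose_mat (A * X) * transpose_mat (A * Y)"
      using transpose_mult[OF m(2) m(1)] by simp
    also have "\<dots> = (A * X) * (A * Y)" using X Y by (simp add: is_pseudoinverse_def)
    also have "\<dots> = A * Y" using X assoc_mult_mat[OF m(1) c(1,3)] by (simp add: is_pseudoinverse_def)
    finally show ?thesis using X by (simp add: is_pseudoinverse_def)
  qed
  have XA: "X * A = Y * A"
  proof -
    have "X * A = (X * A) * (Y * A)"
      using Y assoc_mult_mat[OF m(3) c(3,1)] assoc_mult_mat[OF c(2,1) m(4)]
        assoc_mult_mat[OF c(1,3,1)] by (simp add: is_pseudoinverse_def)
    then have "transpose_mat (X * A) = transpose_mat (Y * A) * transpose_mat (X * A)"
      using transpose_mult[OF m(3) m(4)] by simp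
    also have "\<dots> = (Y * A) * (X * A)" using X Y by (simp add: is_pseudoinverse_def)
    also have "\<dots> = Y * A"
      using X assoc_mult_mat[OF c(3,1) m(3)] assoc_mult_mat[OF c(1,2,1)]
      by (simp add: is_pseudoinverse_def)
    finally show ?thesis using X by (simp add: is_pseudoinverse_def)
  qed
  have "X = X * (A * X)" using X assoc_mult_mat[OF c(2,1,2)] by (simp add: is_pseudoinverse_def)
  also have "\<dots> = X * A * Y" using AX assoc_mult_mat[OF c(2,1,3)] by simp
  also have "\<dots> = Y" using XA Y by (simp add: is_pseudoinverse_def)
  finally show ?thesis .
qed

lemma pseudoinverse_eqI:
  assumes "is_pseudoinverse A X"
  shows "pseudoinverse A = X"
  unfolding pseudoinverse_def
  by (rule the_equality, rule assms, erule is_pseudoinverse_unique, rule assms)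

text \<open>As \<open>inverse 0 = 0\<close>, entrywise inversion is already the pseudoinverse of a
  diagonal matrix, zero entries included.\<close>

lemma pseudoinverse_orthogonal_diag:
  assumes U: "U \<in> carrier_mat n n" and UU: "transpose_mat U * U = 1\<^sub>m n"
  shows "pseudoinverse (U * mat_diag n f * transpose_mat U)
    = U * mat_diag n (\<lambda>i. inverse (f i)) * transpose_mat U"
proof (rule pseudoinverse_eqI)
  have inv: "x * inverse x * x = x" "inverse x * x * inverse x = inverse x" for x :: real
    by (cases "x = 0"; simp)+
  have c: "U * mat_diag n g * transpose_mat U \<in> carrier_mat n n" for g
    using U mult_carrier_mat[OF U mat_diag_dim[of n g]] by (intro mult_carrier_mat) auto
  show "is_pseudoinverse (U * mat_diag n f * transpose_mat U)
      (U * mat_diag n (\<lambda>i. inverse (f i)) * transpose_mat U)"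
    unfolding is_pseudoinverse_def orthogonal_diag_mult[OF U UU] orthogonal_diag_sym[OF U] inv
      carrier_matD[OF c]
    by (intro conjI refl c)
qed

section \<open>Rank\<close>

lemma (in vec_space) col_space_mult_subset:
  assumes A: "A \<in> carrier_mat n m" and B: "B \<in> carrier_mat m k"
  shows "col_space (A * B) \<subseteq> col_space A"
proof
  fix y assume "y \<in> col_space (A * B)"
  then obtain x where x: "x \<in> carrier_vec k" "y = A * B *\<^sub>v x"
    unfolding col_space_eq[OF mult_carrier_mat[OF A B]] using A B by auto
  then have "y = A *\<^sub>v (B *\<^sub>v x)" using A B by (simp add: assoc_mult_mat_vec)
  moreover have "B *\<^sub>v x \<in> carrier_vec m" using B x by simp
  ultimately show "y \<in> col_space A"
    unfolding col_space_eq[OF A] using A by auto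
qed

text \<open>Each of \<open>A\<close> and \<open>A * B\<close> is a right multiple of the other,
  since \<open>A = A * B * C\<close>; so the column spaces coincide.\<close>

lemma (in vec_space) rank_mult_right_inverse:
  assumes A: "A \<in> carrier_mat n m" and B: "B \<in> carrier_mat m m" and C: "C \<in> carrier_mat m m"
    and BC: "B * C = 1\<^sub>m m"
  shows "rank (A * B) = rank A"
proof -
  have "A = A * B * C" using A BC assoc_mult_mat[OF A B C] by simp
  then have "col_space A = col_space (A * B)"
    using col_space_mult_subset[OF A B] col_space_mult_subset[OF mult_carrier_mat[OF A B] C] by simp
  then show ?thesis by (simp add: rank_def col_space_def)
qed

text \<open>The columns of \<open>B\<close> are orthogonal for the inner product weighted by
  \<open>\<alpha>\<close>, with squared norms \<open>f j\<close>. So columns with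
  \<open>f j = 0\<close> vanish and the others are independent.\<close>

lemma rank_weighted_orthogonal:
  fixes B :: "real mat" and \<alpha> f :: "nat \<Rightarrow> real"
  assumes B: "B \<in> carrier_mat v s" and \<alpha>: "\<And>i. i < v \<Longrightarrow> \<alpha> i > 0"
    and orth: "\<And>j k. j < s \<Longrightarrow> k < s \<Longrightarrow>
      (\<Sum>i<v. \<alpha> i * B $$ (i, j) * B $$ (i, k)) = (if j = k then f j else 0)"
  shows "vec_space.rank v B = card {j. j < s \<and> f j \<noteq> 0}" and "\<And>j. j < s \<Longrightarrow> f j \<ge> 0"
proof -
  interpret vec_space "TYPE(real)" v .
  have f: "f j = (\<Sum>i<v. \<alpha> i * (B $$ (i, j))\<^sup>2)" if "j < s" for j
    using orth[OF that that] by (simp add: power2_eq_square mult.assoc)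
  then show nonneg: "f j \<ge> 0" if "j < s" for j
    using that \<alpha> by (auto intro!: sum_nonneg mult_nonneg_nonneg simp: less_imp_le)
  let ?J = "{j. j < s \<and> f j \<noteq> 0}"
  let ?S = "col B ` ?J"
  have colB: "col B j $ i = B $$ (i, j)" if "i < v" "j < s" for i j using that B by simp
  have carr: "?S \<subseteq> carrier_vec v" using B by auto
  have null: "col B j = 0\<^sub>v v" if "j < s" "f j = 0" for j
  proof (rule eq_vecI)
    fix i assume "i < dim_vec (0\<^sub>v v :: real vec)"
    then have i: "i < v" by simp
    have "\<forall>i\<in>{..<v}. \<alpha> i * (B $$ (i, j))\<^sup>2 = 0"
      using f[OF that(1)] that(2) \<alpha>
      by (subst sum_nonneg_eq_0_iff[symmetric]) (auto simp: less_imp_le)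
    then have "\<alpha> i * (B $$ (i, j))\<^sup>2 = 0" using i by blast
    then show "col B j $ i = 0\<^sub>v v $ i" using i \<alpha>[OF i] that B by auto
  qed (use B in auto)
  have form: "(\<Sum>i<v. \<alpha> i * col B j $ i * col B k $ i) = (if j = k then f j else 0)"
    if "j < s" "k < s" for j k
    unfolding orth[OF that, symmetric] by (intro sum.cong) (auto simp: colB that)
  \<comment> \<open>Equal columns with different indices would give \<open>f j = 0\<close> by
    \<open>form\<close>.\<close>
  have inj: "inj_on (col B) ?J"
  proof (rule inj_onI)
    fix j k assume jk: "j \<in> ?J" "k \<in> ?J" "col B j = col B k"
    then show "j = k" using form[of j k] form[of j j] by (auto split: if_splits)
  qed
  have indpt: "lin_indpt ?S"
  proof (rule finite_lin_indpt2)
    show "finite ?S" by simp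
    fix a assume z: "lincomb a ?S = 0\<^sub>v v"
    show "\<forall>x\<in>?S. a x = 0"
    proof
      fix x assume "x \<in> ?S"
      then obtain j where j: "j \<in> ?J" "x = col B j" by auto
      \<comment> \<open>Pair the linear relation with column \<open>j\<close> in the weighted inner
        product; only the summand for \<open>k = j\<close> survives.\<close>
      have "0 = (\<Sum>i<v. \<alpha> i * x $ i * (lincomb a ?S $ i))"
        using z by simp
      also have "\<dots> = (\<Sum>i<v. \<Sum>k\<in>?J. a (col B k) * (\<alpha> i * col B j $ i * col B k $ i))"
        by (intro sum.cong refl, subst lincomb_index)
          (use carr in \<open>auto simp: sum.reindex[OF inj] sum_distrib_left j(2) mult_ac\<close>)
      also have "\<dots> = (\<Sum>k\<in>?J. a (col B k) * (\<Sum>i<v. \<alpha> i * col B j $ i * col B k $ i))"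
        by (subst sum.swap) (simp add: sum_distrib_left)
      also have "\<dots> = (\<Sum>k\<in>?J. if k = j then a (col B j) * f j else 0)"
        using j form by (intro sum.cong) auto
      also have "\<dots> = a x * f j" using j by simp
      finally show "a x = 0" using j by simp
    qed
  qed (use carr in simp)
  \<comment> \<open>A column outside \<open>?S\<close> is zero, so no independent set of columns
    properly contains \<open>?S\<close>.\<close>
  have "maximal ?S (\<lambda>T. T \<subseteq> set (cols B) \<and> lin_indpt T)"
    unfolding maximal_def
  proof (intro conjI allI impI)
    show "?S \<subseteq> set (cols B)" using B by (auto simp: cols_def)
    fix T assume T: "?S \<subseteq> T \<and> T \<subseteq> set (cols B) \<and> lin_indpt T"
    have "T \<subseteq> ?S"
    proof
      fix x assume x: "x \<in> T"
      then obtain j where j: "j < s" "x = col B j" using T B by (auto simp: cols_def)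
      have "T \<subseteq> carrier_vec v" using T B cols_dim[of B] by auto
      moreover have "(UNIV :: real set) \<noteq> {0}" by (metis UNIV_I singletonD zero_neq_one)
      ultimately have "0\<^sub>v v \<notin> T" using T zero_nin_lin_indpt[of T] by simp
      then have "x \<noteq> 0\<^sub>v v" using x by auto
      then show "x \<in> ?S" using null j by auto
    qed
    then show "T = ?S" using T by blast
  qed (rule indpt)
  then have "rank B = card ?S" by (rule rank_card_indpt[OF B])
  then show "rank B = card ?J" by (simp add: card_image[OF inj])
qed

section \<open>Minors of the bordered incidence matrix\<close>

text \<open>Index \<open>v + c\<close> stands for comparison \<open>c\<close>. The diagonal blocks
  are zero because the weights and \<open>x\<close> enter as the \<open>d\<close> of
  \<open>det_add_diag\<close>. The opposite signs of \<open>Q\<close> in the two other blocks offset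
  the minus sign of \<open>pminor_pendant\<close>, so that the minors come out as 0 or 1.\<close>

definition bordered :: "nat \<Rightarrow> real mat \<Rightarrow> nat \<Rightarrow> nat \<Rightarrow> real" where
  "bordered v Q i j =
     (if i < v \<and> v \<le> j then - Q $$ (i, j - v)
      else if v \<le> i \<and> j < v then Q $$ (j, i - v) else 0)"

lemma det_mat_diag: "det (mat_diag n f) = (\<Prod>i<n. f i)"
proof -
  have "det (mat_diag n f) = prod_list (diag_mat (mat_diag n f))"
    by (rule det_upper_triangular[of _ n]) (auto simp: mat_diag_def)
  also have "\<dots> = (\<Prod>i = 0..<n. f i)"
    unfolding prod_list_diag_prod by (auto simp: mat_diag_def)
  finally show ?thesis by (simp add: atLeast0LessThan)
qed

lemma V_mat_carrier: "Q \<in> carrier_mat v s \<Longrightarrow> V_mat Q w \<in> carrier_mat s s"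
  unfolding V_mat_def by (intro mult_carrier_mat[of _ s v _ s] mult_carrier_mat[of _ s v _ v]) auto

lemma det_bordered:
  assumes Q: "Q \<in> carrier_mat v s" and w: "\<And>i. i < v \<Longrightarrow> w $ i > 0"
  shows "(\<Prod>i<v. w $ i) * det (V_mat Q w + x \<cdot>\<^sub>m 1\<^sub>m s)
    = det (mat (v + s) (v + s)
        (\<lambda>(i, j). bordered v Q i j + (if i = j then if i < v then w $ i else x else 0)))"
proof -
  define W where "W = mat_diag v (\<lambda>i. w $ i)"
  define D where "D = mat_diag v (\<lambda>i. inverse (w $ i))"
  define M where "M = four_block_mat W (- Q) (transpose_mat Q) (x \<cdot>\<^sub>m 1\<^sub>m s)"
  \<comment> \<open>Right multiplication by \<open>E\<close> adds the first block column times
    \<open>D * Q\<close> to the second. This clears \<open>- Q\<close>, as \<open>W * D\<close> is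
    the identity, and leaves \<open>V_mat Q w + x \<cdot>\<^sub>m 1\<^sub>m s\<close> in the
    corner.\<close>
  define E where "E = four_block_mat (1\<^sub>m v) (D * Q) (0\<^sub>m s v) (1\<^sub>m s)"
  have c: "W \<in> carrier_mat v v" "D \<in> carrier_mat v v" "transpose_mat Q \<in> carrier_mat s v"
    "- Q \<in> carrier_mat v s" "x \<cdot>\<^sub>m 1\<^sub>m s \<in> carrier_mat s s"
    using Q by (auto simp: W_def D_def)
  have DQ: "D * Q \<in> carrier_mat v s" using c Q by simp
  have "w $ i * inverse (w $ i) = 1" if "i < v" for i using w[OF that] by simp
  then have "W * D = 1\<^sub>m v"
    unfolding W_def D_def mat_diag_diag by (intro eq_matI) (auto simp: mat_diag_def)
  then have WDQ: "W * (D * Q) = Q" using assoc_mult_mat[OF c(1,2) Q] Q by simp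
  have V: "V_mat Q w = transpose_mat Q * (D * Q)"
    unfolding V_mat_def D_def using assoc_mult_mat[OF c(3,2) Q] Q by (simp add: D_def)
  have "M * E = four_block_mat (W * 1\<^sub>m v + - Q * 0\<^sub>m s v) (W * (D * Q) + - Q * 1\<^sub>m s)
      (transpose_mat Q * 1\<^sub>m v + x \<cdot>\<^sub>m 1\<^sub>m s * 0\<^sub>m s v)
      (transpose_mat Q * (D * Q) + x \<cdot>\<^sub>m 1\<^sub>m s * 1\<^sub>m s)"
    unfolding M_def E_def using c DQ by (intro mult_four_block_mat) auto
  also have "\<dots> = four_block_mat W (0\<^sub>m v s) (transpose_mat Q) (V_mat Q w + x \<cdot>\<^sub>m 1\<^sub>m s)"
    unfolding WDQ V
  proof (intro cong_four_block_mat)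
    show "W * 1\<^sub>m v + - Q * 0\<^sub>m s v = W" using c Q by (intro eq_matI) auto
    show "Q + - Q * 1\<^sub>m s = 0\<^sub>m v s" using c Q by (intro eq_matI) auto
    show "transpose_mat Q * 1\<^sub>m v + x \<cdot>\<^sub>m 1\<^sub>m s * 0\<^sub>m s v = transpose_mat Q"
      using c Q by (intro eq_matI) auto
    show "transpose_mat Q * (D * Q) + x \<cdot>\<^sub>m 1\<^sub>m s * 1\<^sub>m s = transpose_mat Q * (D * Q) + x \<cdot>\<^sub>m 1\<^sub>m s"
      using right_mult_one_mat[OF c(5)] by simp
  qed
  finally have ME: "M * E = four_block_mat W (0\<^sub>m v s) (transpose_mat Q) (V_mat Q w + x \<cdot>\<^sub>m 1\<^sub>m s)" .
  have "det (M * E) = det W * det (V_mat Q w + x \<cdot>\<^sub>m 1\<^sub>m s)"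
    unfolding ME using c V_mat_carrier[OF Q, of w]
    by (intro det_four_block_mat_upper_right_zero) auto
  moreover have "det (M * E) = det M * det E"
    using c DQ four_block_carrier_mat[OF c(1) c(5)]
      four_block_carrier_mat[OF one_carrier_mat[of v] one_carrier_mat[of s]]
    unfolding M_def E_def by (intro det_mult[of _ "v + s"]) auto
  moreover have "det E = 1"
    unfolding E_def using DQ
    by (subst det_four_block_mat_lower_left_zero[of _ v _ s]) auto
  moreover have "M = mat (v + s) (v + s)
      (\<lambda>(i, j). bordered v Q i j + (if i = j then if i < v then w $ i else x else 0))"
    unfolding M_def W_def using Q by (intro eq_matI) (auto simp: bordered_def mat_diag_def)
  ultimately show ?thesis by (simp add: W_def det_mat_diag)
qed

section \<open>Splitting index sets into vertices and comparisons\<close>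

lemma sum_Pow_shifted_union:
  fixes g :: "nat set \<Rightarrow> 'b :: comm_monoid_add"
  shows "(\<Sum>U\<in>Pow {0..<v + s}. g U)
    = (\<Sum>R\<in>Pow {..<v}. \<Sum>T\<in>Pow {..<s}. g (R \<union> (+) v ` T))"
  unfolding sum.cartesian_product
proof (rule sum.reindex_bij_witness[of _ "\<lambda>(R, T). R \<union> (+) v ` T"
      "\<lambda>U. (U \<inter> {..<v}, {c. v + c \<in> U})"])
  fix U assume U: "U \<in> Pow {0..<v + s}"
  have "x \<in> (+) v ` {c. v + c \<in> U}" if "x \<in> U" "\<not> x < v" for x
    using that by (intro image_eqI[of _ _ "x - v"]) auto
  then show "(case (U \<inter> {..<v}, {c. v + c \<in> U}) of (R, T) \<Rightarrow> R \<union> (+) v ` T) = U" by auto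
  then show "(case (U \<inter> {..<v}, {c. v + c \<in> U}) of (R, T) \<Rightarrow> g (R \<union> (+) v ` T)) = g U" by simp
  show "(U \<inter> {..<v}, {c. v + c \<in> U}) \<in> Pow {..<v} \<times> Pow {..<s}" using U by auto
qed auto

lemma prod_shifted_complement:
  fixes x :: "'b :: comm_monoid_mult"
  assumes "R \<subseteq> {..<v}" "T \<subseteq> {..<s}"
  shows "(\<Prod>i\<in>{0..<v + s} - (R \<union> (+) v ` T). if i < v then f i else x)
    = (\<Prod>i\<in>{..<v} - R. f i) * x ^ (s - card T)"
proof -
  have "{0..<v + s} - (R \<union> (+) v ` T) = ({..<v} - R) \<union> (+) v ` ({..<s} - T)"
  proof (intro equalityI subsetI)
    fix i assume i: "i \<in> {0..<v + s} - (R \<union> (+) v ` T)"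
    show "i \<in> ({..<v} - R) \<union> (+) v ` ({..<s} - T)"
    proof (cases "i < v")
      case False
      then have "i = v + (i - v)" by simp
      moreover have "i - v \<in> {..<s} - T" using i False by (auto simp: image_iff)
      ultimately show ?thesis by blast
    qed (use i in auto)
  qed (use assms in auto)
  moreover have "(\<Prod>i\<in>(+) v ` ({..<s} - T). if i < v then f i else x) = x ^ (s - card T)"
    using assms(2) by (subst prod.reindex) (auto simp: card_Diff_subset finite_subset)
  ultimately show ?thesis
    by (simp, subst prod.union_disjoint) (auto intro!: arg_cong2[of _ _ _ _ "(*)"] prod.cong)
qed

text \<open>The minor of \<open>bordered\<close> on \<open>R \<union> T\<close> is the square of the minor of \<open>Q\<close> with
  rows \<open>R\<close> and columns \<open>T\<close>; a pendant vertex in \<open>R\<close> allows it to be expanded.\<close>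

lemma pminor_bordered:
  assumes Q: "\<And>k c. k < v \<Longrightarrow> c < s \<Longrightarrow>
      Q $$ (k, c) = of_bool (k = fst (e c)) - of_bool (k = snd (e c))"
    and e: "\<And>c. c < s \<Longrightarrow> fst (e c) < v \<and> snd (e c) < v \<and> fst (e c) \<noteq> snd (e c)"
    and "R \<subseteq> {..<v}" "T \<subseteq> {..<s}"
  shows "pminor (bordered v Q) (R \<union> (+) v ` T)
    = of_bool (card R = card T \<and> reaches {..<v} ({..<v} - R) (e ` T))"
  using assms(3,4)
proof (induction "card R" arbitrary: R T)
  let ?N = "bordered v Q" and ?V = "{..<v}"
  have cardT: "card ((+) v ` T) = card T" for T by (rule card_image) simp
  \<comment> \<open>The zero diagonal blocks of \<open>bordered\<close> give the bipartite
    pattern.\<close>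
  have unequal: "pminor ?N (R \<union> (+) v ` T) = 0"
    if "R \<subseteq> ?V" "T \<subseteq> {..<s}" "card R \<noteq> card T" for R T
    using that cardT[of T]
    by (intro pminor_bipartite_card) (auto simp: bordered_def intro: finite_subset)
  {
    case 0
    then have R: "R = {}" using finite_subset[OF 0(2)] by simp
    show ?case
    proof (cases "T = {}")
      case True
      then show ?thesis by (auto simp: R reaches_def)
    next
      case False
      then have "card R \<noteq> card T" using 0(3) R by (auto simp: card_eq_0_iff finite_subset)
      then show ?thesis using unequal[OF 0(2,3)] by simp
    qed
  next
    case (Suc n)
    note RT = Suc.prems
    have fin: "finite R" "finite T" using RT by (auto intro: finite_subset)
    let ?U = "R \<union> (+) v ` T"
    show ?case
    proof (cases "card R = card T")
      case False
      then show ?thesis using unequal[OF RT] by simp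
    next
      case eq: True
      have inc: "Q $$ (k, c) = 0 \<longleftrightarrow> \<not> incident k (e c)" if "k \<in> R" "c \<in> T" for k c
      proof -
        have "k < v" "c < s" using that RT by auto
        then show ?thesis using Q[of k c] e[of c] by (auto simp: incident_def)
      qed
      have "fst (e c) \<noteq> snd (e c)" if "c \<in> T" for c using e[of c] that RT(2) by auto
      then have "(\<exists>i\<in>R. \<forall>c\<in>T. \<not> incident i (e c))
          \<or> (\<exists>i\<in>R. \<exists>c\<in>T. incident i (e c) \<and> (\<forall>d\<in>T. d \<noteq> c \<longrightarrow> \<not> incident i (e d)))
          \<or> (\<forall>c\<in>T. fst (e c) \<in> R \<and> snd (e c) \<in> R)"
        using fin eq by (intro leaf_trichotomy) auto
      then consider (isolated) i where "i \<in> R" "\<forall>c\<in>T. \<not> incident i (e c)"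
        | (leaf) i c where "i \<in> R" "c \<in> T" "incident i (e c)"
            "\<forall>d\<in>T. d \<noteq> c \<longrightarrow> \<not> incident i (e d)"
        | (inside) "\<forall>c\<in>T. fst (e c) \<in> R \<and> snd (e c) \<in> R"
        by blast
      then show ?thesis
      proof cases
        case isolated
        have "pminor ?N ?U = 0"
          using isolated inc RT fin by (intro pminor_zero_row[of _ i]) (auto simp: bordered_def)
        moreover have "\<not> reaches ?V (?V - R) (e ` T)"
          using reaches_imp_not_isolated[of ?V "?V - R" "e ` T" i] isolated RT by auto
        ultimately show ?thesis by simp
      next
        case inside
        have R: "R \<noteq> {}" using Suc.hyps(2) by auto
        \<comment> \<open>Each comparison in \<open>T\<close> has its entries 1 and -1 both in
          \<open>R\<close>, so its row sums to zero over \<open>R\<close>; the rows of vertices are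
          zero on \<open>R\<close> anyway.\<close>
        have "pminor ?N ?U = 0"
        proof (rule pminor_kernel[of _ R])
          fix k assume k: "k \<in> ?U"
          show "(\<Sum>j\<in>R. ?N k j) = 0"
          proof (cases "k < v")
            case True
            then show ?thesis using RT by (intro sum.neutral) (auto simp: bordered_def)
          next
            case False
            then obtain c where c: "c \<in> T" "k = v + c" using k RT by auto
            have "(\<Sum>j\<in>R. ?N k j) = (\<Sum>j\<in>R. of_bool (j = fst (e c)) - of_bool (j = snd (e c)))"
              using c RT by (intro sum.cong) (auto simp: bordered_def Q)
            also have "\<dots> = 0" using inside c(1) fin by (simp add: sum_subtractf of_bool_def)
            finally show ?thesis .
          qed
        qed (use fin R in auto)
        moreover have "\<not> reaches ?V (?V - R) (e ` T)"
          using reaches_imp_crossing_edge[of ?V "?V - R" "e ` T" R] inside RT R by auto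
        ultimately show ?thesis by simp
      next
        case leaf
        let ?R = "R - {i}" and ?T = "T - {c}"
        have i: "i < v" and c: "c < s" using leaf RT by auto
        have "pminor ?N ?U = - (?N i (v + c) * ?N (v + c) i * pminor ?N (?U - {i, v + c}))"
        proof (rule pminor_pendant)
          show "?N i j = 0" if "j \<in> ?U" "j \<noteq> v + c" for j
            using that leaf inc RT i by (auto simp: bordered_def)
          show "?N j i = 0" if "j \<in> ?U" "j \<noteq> v + c" for j
            using that leaf inc RT i by (auto simp: bordered_def)
        qed (use leaf fin i in auto)
        \<comment> \<open>The two entries are \<open>q\<close> and \<open>- q\<close> with
          \<open>q\<close> equal to 1 or -1.\<close>
        also have "?N i (v + c) * ?N (v + c) i = - 1"
          using i c Q[OF i c] e[OF c] leaf(3) by (auto simp: bordered_def incident_def)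
        also have "?U - {i, v + c} = ?R \<union> (+) v ` ?T" using RT i by auto
        also have "pminor ?N (?R \<union> (+) v ` ?T)
            = of_bool (card ?R = card ?T \<and> reaches ?V (?V - ?R) (e ` ?T))"
          using Suc.hyps(2) leaf(1) RT fin by (intro Suc.hyps(1)) auto
        also have "card ?R = card ?T \<longleftrightarrow> card R = card T" using eq leaf(1,2) by simp
        also have "?V - ?R = insert i (?V - R)" using i by auto
        also have "reaches ?V (insert i (?V - R)) (e ` ?T) \<longleftrightarrow> reaches ?V (?V - R) (e ` T)"
        proof -
          obtain b where b: "e c = (i, b) \<or> e c = (b, i)"
            using leaf(3) by (cases "e c") (auto simp: incident_def)
          have "insert (e c) (e ` ?T) = e ` T" using leaf(2) by auto
          moreover have "reaches ?V (?V - R) (insert (e c) (e ` ?T))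
              \<longleftrightarrow> reaches ?V (insert i (?V - R)) (e ` ?T)"
            by (rule reaches_insert_leaf[OF _ b]) (use leaf(1,4) b e[OF c] i in auto)
          ultimately show ?thesis by simp
        qed
        finally show ?thesis by simp
      qed
    qed
  }
qed

section \<open>Spanning forests and eigenvalues\<close>

text \<open>Rewrites \<open>kappa\<close> in the index sets of the minors: non-roots
  \<open>R\<close> instead of roots, and columns \<open>T\<close> instead of edges. By
  \<open>reaches_imp_spanning_forest\<close>, reachability describes the same forests and each of
  them weighs the product over \<open>R\<close>.\<close>

lemma spanning_forest_sum:
  fixes e :: "nat \<Rightarrow> nat \<times> nat"
  assumes e: "\<And>c. c < s \<Longrightarrow> fst (e c) < v \<and> snd (e c) < v \<and> fst (e c) \<noteq> snd (e c)"
    and inj: "inj_on e {..<s}"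
    and G: "vertices G = {..<v}" "edges G = e ` {..<s}"
    and r: "r \<le> v"
  shows "kappa (v - r) G = (\<Sum>R\<in>Pow {..<v}. \<Sum>T\<in>Pow {..<s}.
    of_bool (card R = r \<and> card T = r \<and> reaches {..<v} ({..<v} - R) (e ` T)) * (\<Prod>i\<in>R. vweight G i))"
proof -
  let ?V = "{..<v}"
  let ?F = "\<lambda>R. {T \<in> Pow {..<s}. card T = r \<and> reaches ?V (?V - R) (e ` T)}"
  have forests: "kappa_roots G (?V - R) = (\<Sum>T\<in>?F R. \<Prod>i\<in>R. vweight G i)"
    if R: "R \<subseteq> ?V" "card R = r" for R
  proof -
    have cardS: "card (?V - R) = v - r" using R by (simp add: card_Diff_subset finite_subset)
    have cardT: "card (e ` T) = card T" if "T \<subseteq> {..<s}" for T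
      using inj that by (metis card_image inj_on_subset)
    have char: "spans_forest_with_roots G (?V - R) (e ` T)
        \<and> forest_weight (vweight G) (orient_towards (?V - R) (e ` T)) = (\<Prod>i\<in>R. vweight G i)"
      if T: "T \<in> ?F R" for T
    proof -
      have eT: "e ` T \<subseteq> ?V \<times> ?V"
      proof
        fix x assume "x \<in> e ` T"
        then obtain c where "c < s" "x = e c" using T by auto
        then show "x \<in> ?V \<times> ?V" using e[of c] by (cases "e c") auto
      qed
      moreover have "fst x \<noteq> snd x" if "x \<in> e ` T" for x using that e T by auto
      moreover have "card (e ` T) = card ?V - card (?V - R)"
        using T r cardT cardS by auto
      moreover have "reaches ?V (?V - R) (e ` T)" using T by simp
      ultimately have "cycle_free (e ` T)
          \<and> (\<forall>u\<in>?V. \<exists>!s. s \<in> ?V - R \<and> (u, s) \<in> (undirected (e ` T))\<^sup>*)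
          \<and> forest_weight (vweight G) (orient_towards (?V - R) (e ` T)) = (\<Prod>i\<in>?V - (?V - R). vweight G i)"
        by (intro reaches_imp_spanning_forest) auto
      moreover have "?V - (?V - R) = R" using R by auto
      moreover have "e ` T \<subseteq> edges G" using T G by auto
      ultimately show ?thesis
        using \<open>card (e ` T) = card ?V - card (?V - R)\<close> G by (simp add: spans_forest_with_roots_def)
    qed
    have "{X. spans_forest_with_roots G (?V - R) X} = (`) e ` ?F R"
    proof (intro equalityI subsetI)
      fix X assume "X \<in> {X. spans_forest_with_roots G (?V - R) X}"
      then have X: "X \<subseteq> e ` {..<s}" "card X = r" "reaches ?V (?V - R) X"
        using G cardS r by (auto simp: spans_forest_with_roots_def reaches_def)
      obtain T where T: "T \<subseteq> {..<s}" "X = e ` T" using X(1) by (auto simp: subset_image_iff)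
      then have "T \<in> ?F R" using X cardT by auto
      then show "X \<in> (`) e ` ?F R" using T by blast
    next
      fix X assume "X \<in> (`) e ` ?F R"
      then show "X \<in> {X. spans_forest_with_roots G (?V - R) X}" using char by auto
    qed
    moreover have "inj_on ((`) e) (?F R)"
      using inj_on_image_Pow[OF inj] by (rule inj_on_subset) auto
    ultimately have "kappa_roots G (?V - R)
        = (\<Sum>T\<in>?F R. forest_weight (vweight G) (orient_towards (?V - R) (e ` T)))"
      unfolding kappa_roots_def by (simp add: sum.reindex)
    also have "\<dots> = (\<Sum>T\<in>?F R. \<Prod>i\<in>R. vweight G i)"
      using char by (intro sum.cong) auto
    finally show ?thesis .
  qed
  \<comment> \<open>Complementation is a bijection between sizes because \<open>r \<le> v\<close>
    gives \<open>v - (v - r) = r\<close> despite truncated subtraction.\<close>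
  have "kappa (v - r) G = (\<Sum>R | R \<subseteq> ?V \<and> card R = r. kappa_roots G (?V - R))"
    unfolding kappa_def G(1)
    by (rule sum.reindex_bij_witness[of _ "\<lambda>R. ?V - R" "\<lambda>S. ?V - S"])
      (use r in \<open>auto simp: card_Diff_subset finite_subset double_diff\<close>)
  also have "\<dots> = (\<Sum>R | R \<subseteq> ?V \<and> card R = r. \<Sum>T\<in>?F R. \<Prod>i\<in>R. vweight G i)"
    using forests by (intro sum.cong) auto
  also have "\<dots> = (\<Sum>R\<in>Pow ?V. of_bool (card R = r) * (\<Sum>T\<in>?F R. \<Prod>i\<in>R. vweight G i))"
    by (rule sum.mono_neutral_cong_left) auto
  also have "\<dots> = (\<Sum>R\<in>Pow ?V. \<Sum>T\<in>Pow {..<s}.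
      of_bool (card R = r \<and> card T = r \<and> reaches ?V (?V - R) (e ` T)) * (\<Prod>i\<in>R. vweight G i))"
  proof (intro sum.cong refl)
    fix R assume "R \<in> Pow ?V"
    have "(\<Sum>T\<in>?F R. \<Prod>i\<in>R. vweight G i)
        = (\<Sum>T\<in>Pow {..<s}. of_bool (card T = r \<and> reaches ?V (?V - R) (e ` T)) * (\<Prod>i\<in>R. vweight G i))"
      by (rule sum.mono_neutral_cong_left) auto
    then show "of_bool (card R = r) * (\<Sum>T\<in>?F R. \<Prod>i\<in>R. vweight G i)
        = (\<Sum>T\<in>Pow {..<s}. of_bool (card R = r \<and> card T = r \<and> reaches ?V (?V - R) (e ` T))
            * (\<Prod>i\<in>R. vweight G i))"
      by (cases "card R = r") auto
  qed
  finally show ?thesis .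
qed

text \<open>The \<open>s - r\<close> factors with \<open>f j = 0\<close> are bare variables, so the
  coefficient is the constant term of the product of the others.\<close>

lemma coeff_prod_linear:
  fixes f :: "nat \<Rightarrow> 'a :: idom"
  assumes r: "card {j. j < s \<and> f j \<noteq> 0} = r"
  shows "coeff (\<Prod>j<s. [:f j, 1:]) (s - r) = (\<Prod>j | j < s \<and> f j \<noteq> 0. f j)"
proof -
  let ?J = "{j. j < s \<and> f j \<noteq> 0}"
  have J: "?J \<subseteq> {..<s}" by auto
  have "(\<Prod>j<s. [:f j, 1:]) = (\<Prod>j\<in>{..<s} - ?J. [:f j, 1:]) * (\<Prod>j\<in>?J. [:f j, 1:])"
    using prod.subset_diff[OF J] by blast
  also have "(\<Prod>j\<in>{..<s} - ?J. [:f j, 1:]) = (\<Prod>j\<in>{..<s} - ?J. monom 1 1)"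
    by (intro prod.cong) (auto simp: monom_altdef)
  also have "\<dots> = monom 1 (s - r)"
    using r J by (simp add: card_Diff_subset finite_subset monom_power)
  also have "coeff (monom 1 (s - r) * (\<Prod>j\<in>?J. [:f j, 1:])) (s - r) = poly (\<Prod>j\<in>?J. [:f j, 1:]) 0"
    by (simp add: coeff_monom_mult poly_0_coeff_0)
  finally show ?thesis by (simp add: poly_prod)
qed

text \<open>For \<open>B = Q * U\<close> the product \<open>transpose_mat B * (D * B)\<close> is
  diagonal with entries \<open>f j\<close>, so \<open>rank_weighted_orthogonal\<close> yields both
  nonnegativity and the count of nonzero \<open>f j\<close>. The orthogonal factor \<open>U\<close>
  does not change the rank.\<close>

lemma V_mat_diagonalization:
  assumes Q: "Q \<in> carrier_mat v s" and w: "\<And>i. i < v \<Longrightarrow> w $ i > 0"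
  obtains U f where "U \<in> carrier_mat s s" "transpose_mat U * U = 1\<^sub>m s"
    "V_mat Q w = U * mat_diag s f * transpose_mat U"
    "mat_rank Q = card {j. j < s \<and> f j \<noteq> 0}" "\<And>j. j < s \<Longrightarrow> f j \<ge> 0"
proof -
  define D where "D = mat_diag v (\<lambda>i. inverse (w $ i))"
  have D: "D \<in> carrier_mat v v" by (simp add: D_def)
  have Qt: "transpose_mat Q \<in> carrier_mat s v" using Q by simp
  have V: "V_mat Q w = transpose_mat Q * (D * Q)"
    unfolding V_mat_def D_def using assoc_mult_mat[OF Qt D Q] Q by (simp add: D_def)
  have DQ: "D * Q \<in> carrier_mat v s" using D Q by simp
  have "transpose_mat D = D" unfolding D_def by (rule eq_matI) (auto simp: mat_diag_def)
  then have "transpose_mat (V_mat Q w) = V_mat Q w"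
    unfolding V using transpose_mult[OF Qt DQ] transpose_mult[OF D Q] assoc_mult_mat[OF Qt D Q] by simp
  then obtain U f where U: "U \<in> carrier_mat s s" "transpose_mat U * U = 1\<^sub>m s"
    and VU: "V_mat Q w = U * mat_diag s f * transpose_mat U"
    using symmetric_real_diagonalization[OF V_mat_carrier[OF Q]] by blast
  have Ut: "transpose_mat U \<in> carrier_mat s s" using U by simp
  have F: "mat_diag s f \<in> carrier_mat s s" by simp
  define B where "B = Q * U"
  have B: "B \<in> carrier_mat v s" using Q U by (simp add: B_def)
  have "transpose_mat B * (D * B) = transpose_mat U * (transpose_mat Q * (D * Q) * U)"
    unfolding B_def transpose_mult[OF Q U(1)]
    using assoc_mult_mat[OF D Q U(1)] assoc_mult_mat[OF Qt DQ U(1)]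
      assoc_mult_mat[OF Ut Qt mult_carrier_mat[OF DQ U(1)]] by simp
  also have "\<dots> = transpose_mat U * (U * mat_diag s f * transpose_mat U * U)"
    unfolding VU[symmetric] V ..
  also have "\<dots> = mat_diag s f"
  proof -
    have UF: "U * mat_diag s f \<in> carrier_mat s s" using U F by (intro mult_carrier_mat)
    have "U * mat_diag s f * transpose_mat U * U = U * mat_diag s f"
      unfolding assoc_mult_mat[OF UF Ut U(1)] U(2) by (rule right_mult_one_mat[OF UF])
    then show ?thesis
      using assoc_mult_mat[OF Ut U(1) F] left_mult_one_mat[OF F] by (simp add: U(2))
  qed
  finally have BDB: "transpose_mat B * (D * B) = mat_diag s f" .
  have orth: "(\<Sum>i<v. inverse (w $ i) * B $$ (i, j) * B $$ (i, k)) = (if j = k then f j else 0)"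
    if "j < s" "k < s" for j k
  proof -
    have "(if j = k then f j else 0) = (transpose_mat B * (D * B)) $$ (j, k)"
      unfolding BDB using that by (simp add: mat_diag_def)
    also have "\<dots> = (\<Sum>i<v. B $$ (i, j) * (inverse (w $ i) * B $$ (i, k)))"
      unfolding D_def mat_diag_mult_left[OF B] using B that
      by (simp add: scalar_prod_def atLeast0LessThan)
    finally show ?thesis by (simp add: mult_ac)
  qed
  have "U * transpose_mat U = 1\<^sub>m s" using mat_mult_left_right_inverse[OF Ut U(1,2)] .
  then have "mat_rank Q = vec_space.rank v B"
    unfolding mat_rank_def B_def using Q vec_space.rank_mult_right_inverse[OF Q U(1) Ut] by simp
  then have "mat_rank Q = card {j. j < s \<and> f j \<noteq> 0}"
    using rank_weighted_orthogonal(1)[OF B _ orth] w by simp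
  moreover have "f j \<ge> 0" if "j < s" for j
    using rank_weighted_orthogonal(2)[OF B _ orth that] w by simp
  ultimately show thesis using that U VU by blast
qed

lemma comparison_edges:
  assumes pc: "pairwise_comparisons v s Q"
  obtains e where "\<And>c. c < s \<Longrightarrow> fst (e c) < v \<and> snd (e c) < v \<and> fst (e c) \<noteq> snd (e c)"
    "\<And>k c. k < v \<Longrightarrow> c < s \<Longrightarrow> Q $$ (k, c) = of_bool (k = fst (e c)) - of_bool (k = snd (e c))"
    "inj_on e {..<s}" "edges (comparison_graph Q w) = e ` {..<s}"
proof -
  have Q: "Q \<in> carrier_mat v s" using pc by (simp add: pairwise_comparisons_def)
  have "\<forall>c. \<exists>p. c < s \<longrightarrow> fst p < v \<and> snd p < v \<and> fst p \<noteq> snd p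
      \<and> col Q c = unit_vec v (fst p) - unit_vec v (snd p)"
    using pc unfolding pairwise_comparisons_def by (metis fst_conv snd_conv)
  then obtain e where e: "\<And>c. c < s \<Longrightarrow> fst (e c) < v \<and> snd (e c) < v \<and> fst (e c) \<noteq> snd (e c)"
    and col: "\<And>c. c < s \<Longrightarrow> col Q c = unit_vec v (fst (e c)) - unit_vec v (snd (e c))"
    by metis
  have entry: "Q $$ (k, c) = of_bool (k = fst (e c)) - of_bool (k = snd (e c))"
    if "k < v" "c < s" for k c
    using arg_cong[OF col[OF that(2)], of "\<lambda>u. u $ k"] that e[OF that(2)] Q by simp
  have inj: "inj_on e {..<s}"
  proof (rule inj_onI)
    fix c d assume cd: "c \<in> {..<s}" "d \<in> {..<s}" "e c = e d"
    then have "col Q c = col Q d" using col by simp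
    then show "c = d" using pc cd by (auto simp: pairwise_comparisons_def)
  qed
  \<comment> \<open>A column determines its ordered pair: \<open>j\<close> is the row of the entry 1
    and \<open>i\<close> that of -1.\<close>
  have ends: "e c = (j, i)"
    if jic: "c < s" "j < v" "i < v" "j \<noteq> i" and eq: "col Q c = unit_vec v j - unit_vec v i" for c j i
  proof -
    have "Q $$ (k, c) = of_bool (k = j) - of_bool (k = i)" if k: "k < v" for k
      using arg_cong[OF eq, of "\<lambda>u. u $ k"] k jic Q by simp
    from this[of j] this[of i] show ?thesis
      using entry[of j c] entry[of i c] jic by (cases "e c") (auto simp: of_bool_def split: if_splits)
  qed
  have "edges (comparison_graph Q w) = e ` {..<s}"
  proof (intro equalityI subsetI)
    fix x assume "x \<in> edges (comparison_graph Q w)"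
    then obtain j i c where "x = (j, i)" "j < v" "i < v" "j \<noteq> i" "c < s"
      "col Q c = unit_vec v j - unit_vec v i"
      using Q by (auto simp: comparison_graph_def)
    then show "x \<in> e ` {..<s}" using ends by (metis image_eqI lessThan_iff)
  next
    fix x assume "x \<in> e ` {..<s}"
    then obtain c where c: "c < s" "x = e c" by auto
    then show "x \<in> edges (comparison_graph Q w)"
      using e[OF c(1)] col[OF c(1)] Q by (cases "e c") (auto simp: comparison_graph_def)
  qed
  then show thesis using that e entry inj by blast
qed

text \<open>Both sides are the coefficient of \<open>x ^ (s - r)\<close> in
  \<open>det (V_mat Q w + x \<cdot>\<^sub>m 1\<^sub>m s)\<close>, read once from the eigenvalues and
  once from the minors.\<close>

lemma prod_eigenvalues_eq_kappa:
  assumes pc: "pairwise_comparisons v s Q" and w: "\<And>i. i < v \<Longrightarrow> w $ i > 0"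
    and U: "U \<in> carrier_mat s s" "transpose_mat U * U = 1\<^sub>m s"
    and V: "V_mat Q w = U * mat_diag s f * transpose_mat U"
    and r: "card {j. j < s \<and> f j \<noteq> 0} = r"
  shows "(\<Prod>j | j < s \<and> f j \<noteq> 0. f j) = kappa (v - r) (comparison_graph Q w)"
proof -
  let ?G = "comparison_graph Q w" and ?V = "{..<v}"
  have Q: "Q \<in> carrier_mat v s" using pc by (simp add: pairwise_comparisons_def)
  obtain e where e: "\<And>c. c < s \<Longrightarrow> fst (e c) < v \<and> snd (e c) < v \<and> fst (e c) \<noteq> snd (e c)"
    and entry: "\<And>k c. k < v \<Longrightarrow> c < s \<Longrightarrow> Q $$ (k, c) = of_bool (k = fst (e c)) - of_bool (k = snd (e c))"
    and inj: "inj_on e {..<s}" and edges: "edges ?G = e ` {..<s}"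
    using comparison_edges[OF pc, of w] by metis
  have G: "vertices ?G = ?V" "vweight ?G = (\<lambda>i. inverse (w $ i))"
    using Q by (auto simp: comparison_graph_def)
  let ?b = "\<lambda>R T. of_bool (card R = card T \<and> reaches ?V (?V - R) (e ` T)) * (\<Prod>i\<in>R. inverse (w $ i)) :: real"
  have expand: "(\<Prod>j<s. x + f j) = (\<Sum>R\<in>Pow ?V. \<Sum>T\<in>Pow {..<s}. ?b R T * x ^ (s - card T))" for x
  proof -
    let ?A = "V_mat Q w + x \<cdot>\<^sub>m 1\<^sub>m s"
    have "(- 1) ^ s * (\<Prod>j<s. x + f j) = (\<Prod>j<s. - 1 * (x + f j))"
      by (simp only: prod.distrib prod_constant card_lessThan)
    \<comment> \<open>The shift by \<open>+ x\<close> is the characteristic polynomial at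
      \<open>- x\<close>, up to the sign \<open>(- 1) ^ s\<close>.\<close>
    also have "\<dots> = poly (char_poly (V_mat Q w)) (- x)"
      unfolding V char_poly_orthogonal_diag[OF U] poly_prod by (intro prod.cong) auto
    also have "\<dots> = det ((- 1) \<cdot>\<^sub>m ?A)"
      unfolding char_poly_matrix[OF V_mat_carrier[OF Q]] char_matrix_def
      using V_mat_carrier[OF Q, of w] by (intro arg_cong[of _ _ det] eq_matI) auto
    also have "\<dots> = (- 1) ^ s * det ?A" using V_mat_carrier[OF Q, of w] by (subst det_smult) auto
    finally have detA: "det ?A = (\<Prod>j<s. x + f j)" by simp
    have nz: "w $ i \<noteq> 0" if "i < v" for i using w[OF that] by simp
    then have w0: "(\<Prod>i<v. w $ i) \<noteq> 0" by simp
    have "(\<Prod>i<v. w $ i) * (\<Prod>j<s. x + f j)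
        = (\<Sum>U\<in>Pow {0..<v + s}. pminor (bordered v Q) U
            * (\<Prod>i\<in>{0..<v + s} - U. if i < v then w $ i else x))"
      unfolding detA[symmetric] by (rule trans[OF det_bordered[OF Q w] det_add_diag])
    also have "\<dots> = (\<Sum>R\<in>Pow ?V. \<Sum>T\<in>Pow {..<s}. (\<Prod>i<v. w $ i) * (?b R T * x ^ (s - card T)))"
      unfolding sum_Pow_shifted_union
    proof (intro sum.cong refl)
      fix R T assume "R \<in> Pow ?V" "T \<in> Pow {..<s}"
      then have RT: "R \<subseteq> ?V" "T \<subseteq> {..<s}" by auto
      have "(\<Prod>i<v. w $ i) * (\<Prod>i\<in>R. inverse (w $ i))
          = (\<Prod>i\<in>?V - R. w $ i) * ((\<Prod>i\<in>R. w $ i) * (\<Prod>i\<in>R. inverse (w $ i)))"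
        using prod.subset_diff[OF RT(1), of "\<lambda>i. w $ i"] by (simp add: mult.assoc)
      also have "(\<Prod>i\<in>R. w $ i) * (\<Prod>i\<in>R. inverse (w $ i)) = 1"
        unfolding prod.distrib[symmetric] using RT(1) nz by (intro prod.neutral) auto
      finally have "(\<Prod>i\<in>?V - R. w $ i) = (\<Prod>i<v. w $ i) * (\<Prod>i\<in>R. inverse (w $ i))" by simp
      moreover have "pminor (bordered v Q) (R \<union> (+) v ` T)
          = of_bool (card R = card T \<and> reaches ?V (?V - R) (e ` T))"
        using entry e RT by (rule pminor_bordered)
      ultimately show "pminor (bordered v Q) (R \<union> (+) v ` T)
            * (\<Prod>i\<in>{0..<v + s} - (R \<union> (+) v ` T). if i < v then w $ i else x)
          = (\<Prod>i<v. w $ i) * (?b R T * x ^ (s - card T))"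
        unfolding prod_shifted_complement[OF RT] by simp
    qed
    also have "\<dots> = (\<Prod>i<v. w $ i) * (\<Sum>R\<in>Pow ?V. \<Sum>T\<in>Pow {..<s}. ?b R T * x ^ (s - card T))"
      by (simp only: sum_distrib_left)
    finally show ?thesis by (rule mult_left_cancel[OF w0, THEN iffD1])
  qed
  \<comment> \<open>Real polynomials that agree at every \<open>x\<close> are equal, so coefficients
    may be compared.\<close>
  have poly_eq: "(\<Prod>j<s. [:f j, 1:]) = (\<Sum>R\<in>Pow ?V. \<Sum>T\<in>Pow {..<s}. monom (?b R T) (s - card T))"
    using expand by (intro poly_eq_poly_eq_iff[THEN iffD1] ext)
      (simp add: poly_prod poly_sum poly_monom add.commute)
  have rs: "r \<le> s" using r card_mono[of "{..<s}" "{j. j < s \<and> f j \<noteq> 0}"] by auto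
  have "(\<Prod>j | j < s \<and> f j \<noteq> 0. f j)
      = (\<Sum>R\<in>Pow ?V. \<Sum>T\<in>Pow {..<s}. coeff (monom (?b R T) (s - card T)) (s - r))"
    unfolding coeff_prod_linear[OF r, symmetric] poly_eq by (simp add: coeff_sum)
  also have "\<dots> = (\<Sum>R\<in>Pow ?V. \<Sum>T\<in>Pow {..<s}.
      of_bool (card R = r \<and> card T = r \<and> reaches ?V (?V - R) (e ` T)) * (\<Prod>i\<in>R. vweight ?G i))"
  proof (intro sum.cong refl)
    fix R T assume "T \<in> Pow {..<s}"
    then have "card T \<le> s" using card_mono[of "{..<s}" T] by auto
    \<comment> \<open>Truncated subtraction is harmless here, as both \<open>card T\<close> and
      \<open>r\<close> are at most \<open>s\<close>.\<close>
    then have "s - card T = s - r \<longleftrightarrow> card T = r" using rs by auto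
    then show "coeff (monom (?b R T) (s - card T)) (s - r)
        = of_bool (card R = r \<and> card T = r \<and> reaches ?V (?V - R) (e ` T)) * (\<Prod>i\<in>R. vweight ?G i)"
      by (auto simp: G)
  qed
  finally have sum: "(\<Prod>j | j < s \<and> f j \<noteq> 0. f j) = \<dots>" .
  \<comment> \<open>Otherwise no \<open>R\<close> has \<open>r\<close> elements and the sum is 0,
    but a product of nonzero \<open>f j\<close> is not.\<close>
  have "r \<le> v"
  proof (rule ccontr)
    assume "\<not> r \<le> v"
    moreover have "card R \<le> v" if "R \<in> Pow ?V" for R using that card_mono[of ?V R] by auto
    ultimately have "card R \<noteq> r" if "R \<in> Pow ?V" for R using that by fastforce
    then have "(\<Prod>j | j < s \<and> f j \<noteq> 0. f j) = 0" unfolding sum by (simp add: sum.neutral)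
    then show False by (simp add: prod_zero_iff)
  qed
  then show ?thesis using sum spanning_forest_sum[OF e inj G(1) edges] by simp
qed

theorem proposition2:
  fixes v s r :: nat and Q :: "real mat" and w :: "real vec"
  assumes "pairwise_comparisons v s Q"
    and "mat_rank Q = r"
    and "design v w" and "feasible w"
  shows "Psi0 Q w = kappa (v - r) (comparison_graph Q w) \<and>
         Phi0 Q w = (1 / kappa (v - r) (comparison_graph Q w)) powr (1 / real r)"
proof -
  have Q: "Q \<in> carrier_mat v s" using assms(1) by (simp add: pairwise_comparisons_def)
  have w: "w $ i > 0" if "i < v" for i
    using assms(3,4) that by (auto simp: design_def feasible_def)
  obtain U f where U: "U \<in> carrier_mat s s" "transpose_mat U * U = 1\<^sub>m s"
    and V: "V_mat Q w = U * mat_diag s f * transpose_mat U"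
    and rank: "mat_rank Q = card {j. j < s \<and> f j \<noteq> 0}" and nonneg: "\<And>j. j < s \<Longrightarrow> f j \<ge> 0"
    using V_mat_diagonalization[OF Q w] by blast
  have r: "card {j. j < s \<and> f j \<noteq> 0} = r" using rank assms(2) by simp
  let ?p = "\<Prod>j | j < s \<and> f j \<noteq> 0. f j"
  have p: "?p = kappa (v - r) (comparison_graph Q w)"
    using prod_eigenvalues_eq_kappa[OF assms(1) w U V r] .
  have "Psi0 Q w = ?p"
    unfolding Psi0_def assms(2) V
    by (intro prod_eig_nonneg nonneg r) (simp only: char_poly_orthogonal_diag[OF U] proots_prod_linear)
  moreover have "(\<Prod>j = 1..r. eig j (C_mat Q w)) = 1 / ?p"
  proof -
    \<comment> \<open>The eigenvalues \<open>inverse (f j)\<close> vanish exactly where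
      \<open>f j\<close> does, so \<open>r\<close> of them are again positive.\<close>
    have "(\<Prod>j = 1..r. eig j (C_mat Q w))
        = (\<Prod>j | j < s \<and> inverse (f j) \<noteq> 0. inverse (f j))"
      unfolding C_mat_def V pseudoinverse_orthogonal_diag[OF U]
      using nonneg r
      by (intro prod_eig_nonneg)
        (simp_all only: char_poly_orthogonal_diag[OF U] proots_prod_linear inverse_nonnegative_iff_nonnegative
          inverse_nonzero_iff_nonzero)
    then show ?thesis by (simp add: prod_inversef[symmetric] divide_inverse o_def)
  qed
  ultimately show ?thesis unfolding Phi0_def assms(2) p by simp
qed

end
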